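(* Let $a>0$ with $\frac2a\in\mathbb{N}$, let $\kappa\ge0$ be a real number such that $\lambda=(2\kappa-1)/a\ge-\frac12$, and let $f\in\mathcal{S}(\mathbb{R})$. Then there exist even functions $F_1,F_2\in\mathcal{S}(\mathbb{R})$ such that for all $y\in\mathbb{R}$ $$\mathcal{F}_{\kappa,a}(f)(y)=F_1\bigl(|y|^{a/2}\bigr)+y\,F_2\bigl(|y|^{a/2}\bigr).$$
   Context: $\mathcal{S}(\mathbb{R})$ is the Schwartz space. The one-dimensional $(\kappa,a)$-generalized Fourier transform is $$\mathcal{F}_{\kappa,a}(f)(y)=\int_{\mathbb{R}}B_{\kappa,a}(x,y)f(x)\,d\mu_{\kappa,a}(x),\qquad d\mu_{\kappa,a}(x)=\frac{|x|^{2\kappa+a-2}\,dx}{2a^{\lambda}\Gamma(\lambda+1)},$$ with $\lambda=(2\kappa-1)/a$ and $$B_{\kappa,a}(x,y)=j_\lambda\Bigl(\tfrac2a|xy|^{a/2}\Bigr)+\frac{\Gamma(\lambda+1)}{\Gamma(\lambda+1+2/a)}\,\frac{e^{-i\pi/a}\,xy}{a^{2/a}}\,j_{\lambda+\frac2a}\Bigl(\tfrac2a|xy|^{a/2}\Bigr),$$ where $j_\nu(x)=2^\nu\Gamma(\nu+1)x^{-\nu}J_\nu(x)$ is the normalized Bessel function ($j_\nu(0)=1$). *)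

theory Defs
  imports "HOL-Analysis.Analysis"
begin

definition iter_deriv :: "nat \<Rightarrow> (real \<Rightarrow> complex) \<Rightarrow> real \<Rightarrow> complex" where
  "iter_deriv n f = ((\<lambda>g x. vector_derivative g (at x)) ^^ n) f"

(* vector_derivative is an unspecified choice where no derivative exists, hence the
   separate condition that every iterated derivative is itself differentiable. *)
definition schwartz :: "(real \<Rightarrow> complex) set" where
  "schwartz = {f. (\<forall>n x. iter_deriv n f differentiable at x) \<and>
                  (\<forall>m n. bdd_above (range (\<lambda>x. \<bar>x\<bar> ^ m * norm (iter_deriv n f x))))}"

(* Bessel function of the first kind, meant for x > 0: since 0 powr 0 = 0, the value at
   x = 0 is not the intended one when \<nu> = 0. At the poles of Gamma, Isabelle's conventions
   give 1 / Gamma = 0, as they should. *)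
definition bessel_J :: "real \<Rightarrow> real \<Rightarrow> real" where
  "bessel_J \<nu> x =
     (x / 2) powr \<nu> * (\<Sum>n. (- 1) ^ n / (fact n * Gamma (\<nu> + real n + 1)) * (x / 2) ^ (2 * n))"

(* The value 1 at 0 is the continuous extension. Only arguments x \<ge> 0 are used below. *)
definition normalized_bessel :: "real \<Rightarrow> real \<Rightarrow> real" where
  "normalized_bessel \<nu> x =
     (if x = 0 then 1 else 2 powr \<nu> * Gamma (\<nu> + 1) * x powr (- \<nu>) * bessel_J \<nu> x)"

definition lam :: "real \<Rightarrow> real \<Rightarrow> real" where
  "lam \<kappa> a = (2 * \<kappa> - 1) / a"

(* The convention 0 powr s = 0 affects the density only on the null set {0}. *)
definition mu :: "real \<Rightarrow> real \<Rightarrow> real measure" where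
  "mu \<kappa> a = density lborel (\<lambda>x. ennreal
     (\<bar>x\<bar> powr (2 * \<kappa> + a - 2) / (2 * a powr lam \<kappa> a * Gamma (lam \<kappa> a + 1))))"

definition B_kernel :: "real \<Rightarrow> real \<Rightarrow> real \<Rightarrow> real \<Rightarrow> complex" where
  "B_kernel \<kappa> a x y =
     of_real (normalized_bessel (lam \<kappa> a) (2 / a * \<bar>x * y\<bar> powr (a / 2)))
     + of_real (Gamma (lam \<kappa> a + 1) / Gamma (lam \<kappa> a + 1 + 2 / a))
       * (exp (- \<i> * of_real (pi / a)) * of_real (x * y) / of_real (a powr (2 / a)))
       * of_real (normalized_bessel (lam \<kappa> a + 2 / a) (2 / a * \<bar>x * y\<bar> powr (a / 2)))"

definition gen_fourier :: "real \<Rightarrow> real \<Rightarrow> (real \<Rightarrow> complex) \<Rightarrow> real \<Rightarrow> complex" where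
  "gen_fourier \<kappa> a f y = (LINT x|mu \<kappa> a. B_kernel \<kappa> a x y * f x)"

end

theory Submission
  imports Defs
begin

text \<open>
  Put \<open>N = 2 / a\<close>, split the integral into the even and odd parts of \<open>f\<close> and substitute \<open>x = t ^ N\<close>.
  Both parts become Hankel-type transforms
  \<open>H \<nu> g u = \<integral> j \<nu> (N t u) g t t powr (2 \<nu> + 1) dt\<close> over \<open>t > 0\<close> of even Schwartz functions: of
  \<open>f (t ^ N) + f (- t ^ N)\<close> with \<open>\<nu> = \<lambda>\<close>, and of \<open>(f (t ^ N) - f (- t ^ N)) / t ^ N\<close> with \<open>\<nu> = \<lambda> + N\<close>.
  Such a transform is Schwartz. Its derivative is a constant times \<open>u H (\<nu> + 1) g\<close>, so only rapid
  decay is needed, for all \<open>\<nu> \<ge> - 1 / 2\<close>. Two integrations by parts give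
  \<open>u\<^sup>2 H \<nu> g = - H \<nu> r / N\<^sup>2\<close> with \<open>r = (2 \<nu> + 2) q + t q'\<close> and \<open>q = g' / t\<close> again even and Schwartz,
  and \<open>H \<nu> r\<close> is bounded because \<open>\<bar>j \<nu>\<bar> \<le> 1\<close>.
\<close>

subsection \<open>Schwartz functions\<close>

text \<open>Two obstacles shape the development. Membership in \<open>schwartz\<close> speaks of all
  iterated derivatives, for which no handy closed formula exists; so each such proof exhibits a
  family of rapidly decreasing functions whose derivatives stay in its span. For the transforms this
  family is \<open>u ^ k * hankel c \<nu> g u\<close>. Differentiation raises the order, hence decay
  is wanted at all higher orders too, not only at the two that occur in the kernel. Integration by
  parts must leave no boundary term at 0, even for \<nu> = - 1 / 2, where the weight
  \<open>t powr (2 * \<nu> + 1)\<close> is constant. It is always done with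
  \<open>t powr (2 * \<nu> + 2)\<close>, whose exponent is at least 1: one pass moves from order
  \<nu> to \<nu> + 1, the other back, and the square of u appears on the way back. Evenness gives
  g'(0) = 0, so that g' / t is Schwartz; it passes to r, so the step can be iterated. The bound on j
  rests on 2 \<nu> + 1 \<ge> 0: the term with j' in Bessel's equation then acts as damping, and j^2
  + j'^2 cannot grow on x \<ge> 0. Since 2 / a is a natural number, x = t ^ N is a polynomial
  substitution and preserves smoothness at 0.\<close>

definition rapidly_decreasing :: "(real \<Rightarrow> complex) \<Rightarrow> bool" where
  "rapidly_decreasing f \<longleftrightarrow> (\<forall>m. \<exists>K. \<forall>x. \<bar>x\<bar> ^ m * norm (f x) \<le> K)"

lemma rapidly_decreasingI:
  "(\<And>m. \<exists>K. \<forall>x. \<bar>x\<bar> ^ m * norm (f x) \<le> K) \<Longrightarrow> rapidly_decreasing f"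
  by (simp add: rapidly_decreasing_def)

lemma rapidly_decreasingE:
  assumes "rapidly_decreasing f"
  obtains K where "K \<ge> 0" "\<And>x. \<bar>x\<bar> ^ m * norm (f x) \<le> K"
proof -
  obtain K where K: "\<And>x. \<bar>x\<bar> ^ m * norm (f x) \<le> K"
    using assms by (auto simp: rapidly_decreasing_def)
  have "0 \<le> \<bar>0::real\<bar> ^ m * norm (f 0)" by simp
  also have "\<dots> \<le> K" by (rule K)
  finally show ?thesis using that K by blast
qed

lemma rapidly_decreasing_add:
  assumes "rapidly_decreasing f" "rapidly_decreasing g"
  shows "rapidly_decreasing (\<lambda>x. f x + g x)"
proof (rule rapidly_decreasingI)
  fix m
  obtain K where K: "\<And>x. \<bar>x\<bar> ^ m * norm (f x) \<le> K" using assms(1) by (rule rapidly_decreasingE) blast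
  obtain L where L: "\<And>x. \<bar>x\<bar> ^ m * norm (g x) \<le> L" using assms(2) by (rule rapidly_decreasingE) blast
  have "\<bar>x\<bar> ^ m * norm (f x + g x) \<le> K + L" for x
  proof -
    have "\<bar>x\<bar> ^ m * norm (f x + g x) \<le> \<bar>x\<bar> ^ m * (norm (f x) + norm (g x))"
      by (intro mult_left_mono norm_triangle_ineq) auto
    then show ?thesis using K[of x] L[of x] by (simp add: distrib_left)
  qed
  then show "\<exists>K. \<forall>x. \<bar>x\<bar> ^ m * norm (f x + g x) \<le> K" by blast
qed

lemma rapidly_decreasing_cmult:
  assumes "rapidly_decreasing f"
  shows "rapidly_decreasing (\<lambda>x. c * f x)"
proof (rule rapidly_decreasingI)
  fix m
  obtain K where K: "\<And>x. \<bar>x\<bar> ^ m * norm (f x) \<le> K" using assms by (rule rapidly_decreasingE) blast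
  have "\<bar>x\<bar> ^ m * norm (c * f x) \<le> norm c * K" for x
    using mult_left_mono[OF K[of x] norm_ge_zero[of c]] by (simp add: norm_mult mult_ac)
  then show "\<exists>K. \<forall>x. \<bar>x\<bar> ^ m * norm (c * f x) \<le> K" by blast
qed

lemma iter_deriv_0: "iter_deriv 0 f = f"
  by (simp add: iter_deriv_def)

lemma iter_deriv_Suc: "iter_deriv (Suc n) f = iter_deriv n (\<lambda>x. vector_derivative f (at x))"
  by (simp add: iter_deriv_def funpow_Suc_right del: funpow.simps)

lemma schwartz_rapidly_decreasing:
  assumes "f \<in> schwartz"
  shows "rapidly_decreasing f"
proof (rule rapidly_decreasingI)
  fix m
  have "bdd_above (range (\<lambda>x. \<bar>x\<bar> ^ m * norm (iter_deriv 0 f x)))"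
    using assms by (simp add: schwartz_def)
  then show "\<exists>K. \<forall>x. \<bar>x\<bar> ^ m * norm (f x) \<le> K"
    by (auto simp: bdd_above_def iter_deriv_0)
qed

lemma schwartz_derivE:
  assumes "f \<in> schwartz"
  obtains f' where "f' \<in> schwartz" "\<And>x. (f has_vector_derivative f' x) (at x)"
proof
  have d: "iter_deriv n f differentiable at x" for n x
    using assms unfolding schwartz_def by blast
  have b: "bdd_above (range (\<lambda>x. \<bar>x\<bar> ^ m * norm (iter_deriv n f x)))" for n m
    using assms by (simp add: schwartz_def)
  show "(\<lambda>x. vector_derivative f (at x)) \<in> schwartz"
    using d[of "Suc n" for n] b[of _ "Suc n" for n] by (simp add: schwartz_def iter_deriv_Suc)
  show "(f has_vector_derivative vector_derivative f (at x)) (at x)" for x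
    using d[of 0 x] by (simp add: iter_deriv_0 vector_derivative_works)
qed

lemma schwartz_isCont:
  assumes "f \<in> schwartz"
  shows "isCont f x"
proof -
  obtain f' where "\<And>x. (f has_vector_derivative f' x) (at x)"
    using assms by (rule schwartz_derivE) blast
  then show ?thesis by (rule has_vector_derivative_continuous)
qed

lemma has_vector_derivative_compose_real:
  assumes "(g has_real_derivative g') (at x)" and "(f has_vector_derivative f') (at (g x))"
  shows "((\<lambda>x. f (g x)) has_vector_derivative g' *\<^sub>R f') (at x)"
  using vector_diff_chain_at[of g g' x f f'] assms
  by (simp add: o_def has_real_derivative_iff_has_vector_derivative)

section \<open>A closure principle for membership in the Schwartz space\<close>

text \<open>The complex span, generated inductively so that properties stable under sums and
  multiples pass from \<open>S\<close> to \<open>lin S\<close> by rule induction.\<close>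

inductive_set lin :: "(real \<Rightarrow> complex) set \<Rightarrow> (real \<Rightarrow> complex) set" for S where
  base: "g \<in> S \<Longrightarrow> g \<in> lin S"
| add: "g \<in> lin S \<Longrightarrow> h \<in> lin S \<Longrightarrow> (\<lambda>x. g x + h x) \<in> lin S"
| cmult: "g \<in> lin S \<Longrightarrow> (\<lambda>x. c * g x) \<in> lin S"

text \<open>By linearity the span of \<open>S\<close> is itself closed under differentiation, so
  every iterated derivative of \<open>f\<close> lies in it and is therefore rapidly decreasing. No
  formula for the n-th derivative is needed, only a family that is large enough.\<close>

lemma schwartz_coinduct:
  assumes rapid: "\<And>g. g \<in> S \<Longrightarrow> rapidly_decreasing g"
    and deriv: "\<And>g. g \<in> S \<Longrightarrow> \<exists>g' \<in> lin S. \<forall>x. (g has_vector_derivative g' x) (at x)"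
    and "f \<in> lin S"
  shows "f \<in> schwartz"
proof -
  have r: "rapidly_decreasing g" if "g \<in> lin S" for g
    using that by induction (auto intro: rapid rapidly_decreasing_add rapidly_decreasing_cmult)
  have d: "\<exists>g' \<in> lin S. \<forall>x. (g has_vector_derivative g' x) (at x)" if "g \<in> lin S" for g
    using that
  proof induction
    case (base g)
    then show ?case by (rule deriv)
  next
    case (add g h)
    then obtain g' h' where "g' \<in> lin S" "h' \<in> lin S"
      "\<And>x. (g has_vector_derivative g' x) (at x)" "\<And>x. (h has_vector_derivative h' x) (at x)"
      by blast
    then show ?case
      by (intro bexI[of _ "\<lambda>x. g' x + h' x"] allI has_vector_derivative_add lin.add)
  next
    case (cmult g c)
    then obtain g' where "g' \<in> lin S" "\<And>x. (g has_vector_derivative g' x) (at x)"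
      by blast
    then show ?case
      by (intro bexI[of _ "\<lambda>x. c * g' x"] allI has_vector_derivative_mult_right lin.cmult)
  qed
  have i: "iter_deriv n g \<in> lin S" if "g \<in> lin S" for n g
    using that
  proof (induction n arbitrary: g)
    case 0
    then show ?case by (simp add: iter_deriv_0)
  next
    case (Suc n)
    obtain g' where "g' \<in> lin S" and g': "\<And>x. (g has_vector_derivative g' x) (at x)"
      using d Suc.prems by blast
    moreover have "(\<lambda>x. vector_derivative g (at x)) = g'"
      using g' by (auto simp: vector_derivative_at)
    ultimately show ?case using Suc.IH by (simp add: iter_deriv_Suc)
  qed
  have "iter_deriv n f differentiable at x" for n x
    using d[OF i[OF \<open>f \<in> lin S\<close>]] differentiableI_vector by blast
  moreover have "bdd_above (range (\<lambda>x. \<bar>x\<bar> ^ m * norm (iter_deriv n f x)))" for m n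
    using r[OF i[OF \<open>f \<in> lin S\<close>, of n]] by (auto simp: rapidly_decreasing_def bdd_above_def)
  ultimately show ?thesis by (simp add: schwartz_def)
qed

text \<open>The space itself serves as the family \<open>S\<close>; closure under sums and multiples
  then costs nothing.\<close>

lemma schwartz_lin:
  assumes "f \<in> lin schwartz"
  shows "f \<in> schwartz"
proof (rule schwartz_coinduct[OF schwartz_rapidly_decreasing _ assms])
  fix g :: "real \<Rightarrow> complex" assume "g \<in> schwartz"
  then obtain g' where "g' \<in> schwartz" "\<And>x. (g has_vector_derivative g' x) (at x)"
    by (rule schwartz_derivE) blast
  then show "\<exists>g' \<in> lin schwartz. \<forall>x. (g has_vector_derivative g' x) (at x)"
    using lin.base by blast
qed

lemma schwartz_add: "f \<in> schwartz \<Longrightarrow> g \<in> schwartz \<Longrightarrow> (\<lambda>x. f x + g x) \<in> schwartz"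
  by (rule schwartz_lin[OF lin.add[OF lin.base lin.base]])

lemma schwartz_cmult: "f \<in> schwartz \<Longrightarrow> (\<lambda>x. c * f x) \<in> schwartz"
  by (rule schwartz_lin[OF lin.cmult[OF lin.base]])

lemma schwartz_diff:
  assumes "f \<in> schwartz" "g \<in> schwartz"
  shows "(\<lambda>x. f x - g x) \<in> schwartz"
  using schwartz_add[OF assms(1) schwartz_cmult[OF assms(2), of "-1"]] by simp

lemma schwartz_reflect:
  assumes "f \<in> schwartz"
  shows "(\<lambda>x. f (- x)) \<in> schwartz"
proof (rule schwartz_coinduct)
  let ?S = "{(\<lambda>x. f (- x)) | f. f \<in> schwartz}"
  show "(\<lambda>x. f (- x)) \<in> lin ?S" using assms by (intro lin.base) auto
  fix g assume "g \<in> ?S"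
  then obtain h where h: "h \<in> schwartz" and g: "g = (\<lambda>x. h (- x))" by blast
  show "rapidly_decreasing g"
  proof (rule rapidly_decreasingI)
    fix m
    obtain K where "\<And>x. \<bar>x\<bar> ^ m * norm (h x) \<le> K"
      using schwartz_rapidly_decreasing[OF h] by (rule rapidly_decreasingE) blast
    then have "\<bar>x\<bar> ^ m * norm (g x) \<le> K" for x
      unfolding g by (metis abs_minus_cancel)
    then show "\<exists>K. \<forall>x. \<bar>x\<bar> ^ m * norm (g x) \<le> K" by blast
  qed
  obtain h' where h': "h' \<in> schwartz" and d: "\<And>x. (h has_vector_derivative h' x) (at x)"
    using h by (rule schwartz_derivE) blast
  show "\<exists>g' \<in> lin ?S. \<forall>x. (g has_vector_derivative g' x) (at x)"
  proof (intro bexI allI)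
    show "(\<lambda>x. (- 1) * h' (- x)) \<in> lin ?S" using h' by (intro lin.cmult lin.base) auto
    show "(g has_vector_derivative (- 1) * h' (- x)) (at x)" for x
      using has_vector_derivative_compose_real[OF DERIV_minus[OF DERIV_ident] d, of x]
      by (simp add: g)
  qed
qed

text \<open>The monomial in front is the generalisation that makes the family closed: the chain rule
  turns h (x ^ N) into a multiple of \<open>x ^ (N - 1)\<close> times h' (x ^ N).\<close>

lemma schwartz_power_compose:
  assumes "f \<in> schwartz" and "N > 0"
  shows "(\<lambda>x. of_real (x ^ k) * f (x ^ N)) \<in> schwartz"
proof (rule schwartz_coinduct)
  let ?S = "{(\<lambda>x. of_real (x ^ k) * f (x ^ N)) | k f. f \<in> schwartz}"
  show "(\<lambda>x. of_real (x ^ k) * f (x ^ N)) \<in> lin ?S" using assms by (intro lin.base) auto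
  fix g assume "g \<in> ?S"
  then obtain k h where h: "h \<in> schwartz" and g: "g = (\<lambda>x. of_real (x ^ k) * h (x ^ N))" by blast
  show "rapidly_decreasing g"
  proof (rule rapidly_decreasingI)
    fix m
    note r = schwartz_rapidly_decreasing[OF h]
    obtain K where K: "K \<ge> 0" "\<And>x. \<bar>x\<bar> ^ (m + k) * norm (h x) \<le> K"
      using r by (rule rapidly_decreasingE) blast
    obtain L where L: "L \<ge> 0" "\<And>x. \<bar>x\<bar> ^ 0 * norm (h x) \<le> L"
      using r by (rule rapidly_decreasingE) blast
    \<comment> \<open>For \<bar>x\<bar> \<le> 1 the powers are at most 1 and boundedness of
      \<open>h\<close> suffices; otherwise \<bar>x\<bar> \<le> \<bar>x ^ N\<bar>, and the decay of
      \<open>h\<close> is used at the point x ^ N.\<close>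
    have "\<bar>x\<bar> ^ m * norm (g x) \<le> K + L" for x
    proof -
      have *: "\<bar>x\<bar> ^ m * norm (g x) = \<bar>x\<bar> ^ (m + k) * norm (h (x ^ N))"
        by (simp add: g norm_mult norm_power power_add)
      show ?thesis
      proof (cases "\<bar>x\<bar> \<le> 1")
        case True
        then have "\<bar>x\<bar> ^ (m + k) * norm (h (x ^ N)) \<le> 1 * norm (h (x ^ N))"
          by (intro mult_right_mono power_le_one) auto
        then show ?thesis using L(2)[of "x ^ N"] K(1) * by simp
      next
        case False
        then have "\<bar>x\<bar> \<le> \<bar>x ^ N\<bar>" using \<open>N > 0\<close> by (simp add: power_abs self_le_power)
        then have "\<bar>x\<bar> ^ (m + k) * norm (h (x ^ N)) \<le> \<bar>x ^ N\<bar> ^ (m + k) * norm (h (x ^ N))"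
          by (intro mult_right_mono power_mono) auto
        then show ?thesis using K(2)[of "x ^ N"] L(1) * by simp
      qed
    qed
    then show "\<exists>K. \<forall>x. \<bar>x\<bar> ^ m * norm (g x) \<le> K" by blast
  qed
  obtain h' where h': "h' \<in> schwartz" and d: "\<And>x. (h has_vector_derivative h' x) (at x)"
    using h by (rule schwartz_derivE) blast
  \<comment> \<open>For \<open>k = 0\<close> the truncated exponent \<open>k - 1\<close> does no
    harm, as its term carries the factor \<open>of_nat k\<close>.\<close>
  let ?g' = "\<lambda>x. of_nat k * (of_real (x ^ (k - 1)) * h (x ^ N))
              + of_nat N * (of_real (x ^ (k + (N - 1))) * h' (x ^ N))"
  show "\<exists>g' \<in> lin ?S. \<forall>x. (g has_vector_derivative g' x) (at x)"
  proof (intro bexI allI)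
    show "?g' \<in> lin ?S" using h h' by (intro lin.add lin.cmult lin.base) blast+
    fix x
    have N: "((\<lambda>x. h (x ^ N)) has_vector_derivative (real N * x ^ (N - 1)) *\<^sub>R h' (x ^ N)) (at x)"
      by (rule has_vector_derivative_compose_real[OF _ d]) (auto intro!: derivative_eq_intros)
    have k: "((\<lambda>x. x ^ k) has_real_derivative real k * x ^ (k - 1)) (at x)"
      by (auto intro!: derivative_eq_intros)
    show "(g has_vector_derivative ?g' x) (at x)"
      using has_vector_derivative_scaleR[OF k N] unfolding g
      by (simp add: scaleR_conv_of_real mult_ac power_add add.commute)
  qed
qed

section \<open>Division of a Schwartz function by the variable\<close>

text \<open>Each derivative in x brings out one factor s, which is why the weight
  \<open>s ^ n\<close> grows along with the order of differentiation.\<close>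

lemma leibniz_rule_unit_interval:
  fixes f f' :: "real \<Rightarrow> complex"
  assumes d: "\<And>x. (f has_vector_derivative f' x) (at x)" and c: "\<And>x. isCont f' x"
  shows "((\<lambda>x. integral (cbox 0 1) (\<lambda>s. of_real (s ^ n) * f (x * s))) has_vector_derivative
           integral (cbox 0 1) (\<lambda>s. of_real (s ^ Suc n) * f' (x * s))) (at x)"
  unfolding cbox_interval
proof (rule leibniz_rule_vector_derivative[where U = UNIV and ?x0.0 = x
      and f = "\<lambda>x s. of_real (s ^ n) * f (x * s)" and fx = "\<lambda>x s. of_real (s ^ Suc n) * f' (x * s)",
      unfolded cbox_interval])
  have cf: "isCont f x" for x using d has_vector_derivative_continuous by blast
  have [continuous_intros]: "continuous_on A (\<lambda>x. f (g x))" "continuous_on A (\<lambda>x. f' (g x))"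
    if "continuous_on A g" for A and g :: "'b::topological_space \<Rightarrow> real"
    using continuous_on_compose2[OF continuous_at_imp_continuous_on that] cf c by blast+
  show "((\<lambda>x. of_real (s ^ n) * f (x * s)) has_vector_derivative
      of_real (s ^ Suc n) * f' (x * s)) (at x within UNIV)" for x s
  proof -
    have "((\<lambda>x. f (x * s)) has_vector_derivative s *\<^sub>R f' (x * s)) (at x)"
      by (rule has_vector_derivative_compose_real[OF _ d]) (auto intro!: derivative_eq_intros)
    from has_vector_derivative_mult_right[OF this, of "of_real s ^ n"] show ?thesis
      by (simp add: scaleR_conv_of_real mult_ac)
  qed
  show "(\<lambda>s. of_real (s ^ n) * f (x * s)) integrable_on {0..1}" for x
    by (intro integrable_continuous_interval continuous_intros)
  show "continuous_on (UNIV \<times> {0..1}) (\<lambda>(x, s). of_real (s ^ Suc n) * f' (x * s))"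
    by (auto simp: case_prod_beta intro!: continuous_intros)
qed auto

lemma schwartz_iter_deriv:
  assumes "f \<in> schwartz"
  shows "iter_deriv n f \<in> schwartz"
  using assms
proof (induction n arbitrary: f)
  case 0
  then show ?case by (simp add: iter_deriv_0)
next
  case (Suc n)
  obtain f' where "f' \<in> schwartz" and f': "\<And>x. (f has_vector_derivative f' x) (at x)"
    using Suc.prems by (rule schwartz_derivE) blast
  moreover have "(\<lambda>x. vector_derivative f (at x)) = f'"
    using f' by (auto simp: vector_derivative_at)
  ultimately show ?case using Suc.IH by (simp add: iter_deriv_Suc)
qed

lemma iter_deriv_has_vector_derivative:
  assumes "f \<in> schwartz"
  shows "(iter_deriv n f has_vector_derivative iter_deriv (Suc n) f x) (at x)"
proof -
  have "iter_deriv n f differentiable at x" using assms unfolding schwartz_def by blast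
  then show ?thesis by (simp add: vector_derivative_works iter_deriv_def)
qed

text \<open>
  With \<open>q n x\<close> the integral of \<open>s ^ n f\<^sup>(\<^sup>n\<^sup>+\<^sup>1\<^sup>) (x s)\<close> over \<open>0 \<le> s \<le> 1\<close>, the quotient is \<open>q 0\<close> and its \<open>n\<close>-th
  derivative is \<open>q n\<close>; the decay follows from \<open>x q n = f\<^sup>(\<^sup>n\<^sup>) - n q (n - 1)\<close>, which involves no integral.
\<close>
lemma schwartz_divide:
  assumes f: "f \<in> schwartz" and f0: "f 0 = 0"
  obtains q where "q \<in> schwartz" "\<And>x. f x = of_real x * q x"
proof -
  define q where "q n x = integral (cbox 0 1) (\<lambda>s. of_real (s ^ n) * iter_deriv (Suc n) f (x * s))" for n x
  have cont: "isCont (iter_deriv n f) x" for n x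
    by (rule schwartz_isCont[OF schwartz_iter_deriv[OF f]])
  have dq: "(q n has_vector_derivative q (Suc n) x) (at x)" for n x
    unfolding q_def[abs_def]
    by (intro leibniz_rule_unit_interval iter_deriv_has_vector_derivative f cont)
  have q0: "f x = of_real x * q 0 x" for x
  proof -
    have "((\<lambda>s. x *\<^sub>R iter_deriv 1 f (x * s)) has_integral f (x * 1) - f (x * 0)) {0..1}"
    proof (rule fundamental_theorem_of_calculus)
      fix s :: real
      have "((\<lambda>s. f (x * s)) has_vector_derivative x *\<^sub>R iter_deriv 1 f (x * s)) (at s)"
        using iter_deriv_has_vector_derivative[OF f, of 0 "x * s"]
        by (intro has_vector_derivative_compose_real)
          (auto simp: iter_deriv_0 intro!: derivative_eq_intros)
      then show "((\<lambda>s. f (x * s)) has_vector_derivative x *\<^sub>R iter_deriv 1 f (x * s)) (at s within {0..1})"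
        by (rule has_vector_derivative_at_within)
    qed simp
    then have "integral {0..1} (\<lambda>s. x *\<^sub>R iter_deriv 1 f (x * s)) = f x"
      by (subst integral_unique) (simp_all add: f0)
    then show ?thesis by (simp add: q_def scaleR_conv_of_real)
  qed
  \<comment> \<open>The identity for \<open>Suc n\<close> is the derivative of the one for
    \<open>n\<close>: the product rule computes one derivative of x q n, the induction hypothesis
    another, and the two must agree. At \<open>n = 0\<close> the term with \<open>n - 1\<close> is
    multiplied by 0.\<close>
  have rec: "of_real x * q n x = iter_deriv n f x - of_nat n * q (n - 1) x" for n x
  proof (induction n arbitrary: x)
    case 0
    then show ?case using q0 by (simp add: iter_deriv_0)
  next
    case (Suc n)
    have "((\<lambda>x. of_real x * q n x) has_vector_derivative of_real x * q (Suc n) x + q n x) (at x)"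
      using has_vector_derivative_scaleR[OF DERIV_ident dq[of n x]]
      by (simp add: scaleR_conv_of_real)
    moreover have "((\<lambda>x. of_real x * q n x) has_vector_derivative
        iter_deriv (Suc n) f x - of_nat n * q n x) (at x)"
    proof (cases n)
      case 0
      then show ?thesis unfolding Suc.IH
        using iter_deriv_has_vector_derivative[OF f, of 0 x] by simp
    next
      case (Suc k)
      then show ?thesis unfolding Suc.IH
        using has_vector_derivative_diff[OF iter_deriv_has_vector_derivative[OF f, of n x]
            has_vector_derivative_mult_right[OF dq[of k x], of "of_nat n"]]
        by simp
    qed
    ultimately have "of_real x * q (Suc n) x + q n x = iter_deriv (Suc n) f x - of_nat n * q n x"
      by (rule vector_derivative_unique_at)
    then show ?case by (simp add: algebra_simps eq_diff_eq)
  qed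
  \<comment> \<open>This is the case m = 0 of the decay. It has to come from the integral, because
    control of x q n says nothing about q n near x = 0.\<close>
  have bounded: "\<exists>K. \<forall>x. norm (q n x) \<le> K" for n
  proof -
    obtain K where K: "K \<ge> 0" "\<And>x. \<bar>x\<bar> ^ 0 * norm (iter_deriv (Suc n) f x) \<le> K"
      using schwartz_rapidly_decreasing[OF schwartz_iter_deriv[OF f]]
      by (rule rapidly_decreasingE) blast
    have "norm (q n x) \<le> K * (1 - 0)" for x
      unfolding q_def cbox_interval
    proof (rule integral_bound)
      show "continuous_on {0..1} (\<lambda>s. complex_of_real (s ^ n) * iter_deriv (Suc n) f (x * s))"
        by (intro continuous_intros continuous_on_compose2[OF continuous_at_imp_continuous_on,
              of UNIV "iter_deriv (Suc n) f"]) (use cont in auto)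
      fix s :: real assume "s \<in> {0..1}"
      then have "\<bar>s ^ n\<bar> \<le> 1" by (simp add: power_le_one)
      then have "\<bar>s ^ n\<bar> * norm (iter_deriv (Suc n) f (x * s)) \<le> 1 * norm (iter_deriv (Suc n) f (x * s))"
        by (intro mult_right_mono) auto
      also have "\<dots> \<le> K" using K(2)[of "x * s"] by simp
      finally show "norm (complex_of_real (s ^ n) * iter_deriv (Suc n) f (x * s)) \<le> K"
        by (simp only: norm_mult norm_of_real)
    qed simp
    then show ?thesis by auto
  qed
  have step: "rapidly_decreasing (q n)"
    if "rapidly_decreasing (\<lambda>x. of_real x * q n x)" for n
  proof (rule rapidly_decreasingI)
    fix m
    show "\<exists>K. \<forall>x. \<bar>x\<bar> ^ m * norm (q n x) \<le> K"
    proof (cases m)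
      case 0
      then show ?thesis using bounded by simp
    next
      case (Suc k)
      obtain K where "\<And>x. \<bar>x\<bar> ^ k * norm (of_real x * q n x) \<le> K"
        using \<open>rapidly_decreasing (\<lambda>x. of_real x * q n x)\<close> by (rule rapidly_decreasingE) blast
      then show ?thesis unfolding Suc by (auto simp: norm_mult mult_ac)
    qed
  qed
  have r: "rapidly_decreasing (q n)" for n
  proof (induction n)
    case 0
    have "f = (\<lambda>x. of_real x * q 0 x)" using q0 by (rule ext)
    then show ?case using schwartz_rapidly_decreasing[OF f] step by metis
  next
    case (Suc n)
    have "rapidly_decreasing (\<lambda>x. iter_deriv (Suc n) f x + (- of_nat (Suc n)) * q (Suc n - 1) x)"
      unfolding diff_Suc_1 by (intro rapidly_decreasing_add rapidly_decreasing_cmult Suc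
          schwartz_rapidly_decreasing schwartz_iter_deriv f)
    then have "rapidly_decreasing (\<lambda>x. of_real x * q (Suc n) x)"
      unfolding rec by (simp only: minus_mult_left[symmetric] add_uminus_conv_diff)
    then show ?case
      by (rule step)
  qed
  show ?thesis
  proof
    show "q 0 \<in> schwartz"
    proof (rule schwartz_coinduct)
      show "q 0 \<in> lin (range q)" by (intro lin.base) auto
    qed (use r dq in \<open>auto intro: lin.base\<close>)
    show "f x = of_real x * q 0 x" for x by (rule q0)
  qed
qed


subsection \<open>Normalized Bessel functions\<close>

text \<open>The hypergeometric function 0F1(; \<nu> + 1; - z). In the variable z = x^2 / 4 the
  normalized Bessel function has no \<open>powr\<close> left, and its identities become identities
  between coefficients.\<close>

definition bessel_series :: "real \<Rightarrow> real \<Rightarrow> real" where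
  "bessel_series \<nu> z = (\<Sum>n. (- 1) ^ n / (fact n * pochhammer (\<nu> + 1) n) * z ^ n)"

text \<open>Every factor c + i of the Pochhammer symbol is at least 1 / 2.\<close>

lemma pochhammer_half_le:
  fixes c :: real
  assumes "c \<ge> 1 / 2"
  shows "(1 / 2) ^ n \<le> pochhammer c n"
proof (induction n)
  case (Suc n)
  have "(1 / 2) ^ n * (1 / 2) \<le> pochhammer c n * (c + real n)"
    using Suc assms by (intro mult_mono) (auto intro: order_trans[OF _ Suc])
  then show ?case by (simp add: pochhammer_Suc)
qed simp

text \<open>Since 1 / \<open>pochhammer (\<nu> + 1) n\<close> is at most 2 ^ n, the exponential
  series of 2 \<bar>z\<bar> is a majorant.\<close>

lemma summable_bessel_series:
  assumes "\<nu> \<ge> - 1 / 2"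
  shows "summable (\<lambda>n. (- 1) ^ n / (fact n * pochhammer (\<nu> + 1) n) * z ^ n :: real)"
proof (rule summable_comparison_test')
  show "summable (\<lambda>n. (2 * \<bar>z\<bar>) ^ n / fact n)"
    using summable_exp[of "2 * \<bar>z\<bar>"] by (simp add: field_simps)
  fix n :: nat
  have p: "(1 / 2) ^ n \<le> pochhammer (\<nu> + 1) n" using assms by (intro pochhammer_half_le) simp
  have pos: "0 < pochhammer (\<nu> + 1) n" by (rule less_le_trans[OF _ p]) simp
  have "1 / pochhammer (\<nu> + 1) n \<le> 1 / (1 / 2) ^ n"
    using p by (intro divide_left_mono mult_pos_pos pos) auto
  then have le: "1 / pochhammer (\<nu> + 1) n \<le> 2 ^ n" by (simp add: power_one_over)
  have "norm ((- 1) ^ n / (fact n * pochhammer (\<nu> + 1) n) * z ^ n)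
      = (\<bar>z\<bar> ^ n / fact n) * (1 / pochhammer (\<nu> + 1) n)"
    using pos by (simp add: abs_mult abs_divide power_abs)
  also have "\<dots> \<le> (\<bar>z\<bar> ^ n / fact n) * 2 ^ n" by (intro mult_left_mono le) auto
  finally show "norm ((- 1) ^ n / (fact n * pochhammer (\<nu> + 1) n) * z ^ n) \<le> (2 * \<bar>z\<bar>) ^ n / fact n"
    by (simp add: power_mult_distrib mult.commute)
qed

text \<open>The factor n + 1 cancels in the factorial, and the Pochhammer symbol of length n + 1
  loses its first factor \<nu> + 1. Differentiation thus raises the order by one.\<close>

lemma diffs_bessel_series:
  "diffs (\<lambda>n. (- 1) ^ n / (fact n * pochhammer (\<nu> + 1) n)) n
    = - (1 / (\<nu> + 1)) * ((- 1) ^ n / (fact n * pochhammer (\<nu> + 1 + 1) n) :: real)"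
  by (simp add: diffs_def pochhammer_rec del: of_nat_Suc)

lemma has_real_derivative_bessel_series:
  assumes "\<nu> \<ge> - 1 / 2"
  shows "(bessel_series \<nu> has_real_derivative - (1 / (\<nu> + 1)) * bessel_series (\<nu> + 1) z) (at z)"
proof -
  let ?c = "\<lambda>\<nu> n. (- 1) ^ n / (fact n * pochhammer (\<nu> + 1) n) :: real"
  have "((\<lambda>z. \<Sum>n. ?c \<nu> n * z ^ n) has_real_derivative (\<Sum>n. diffs (?c \<nu>) n * z ^ n)) (at z)"
    by (intro termdiffs_strong_converges_everywhere summable_bessel_series assms)
  moreover have "(\<Sum>n. diffs (?c \<nu>) n * z ^ n) = - (1 / (\<nu> + 1)) * bessel_series (\<nu> + 1) z"
    unfolding diffs_bessel_series bessel_series_def mult.assoc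
    using summable_bessel_series[of "\<nu> + 1" z] assms by (subst suminf_mult) auto
  ultimately show ?thesis by (simp add: bessel_series_def[abs_def])
qed

text \<open>Writing F for the series, the last term is z times the derivative of F at order \<nu> +
  1, so the claim is that the operator \<nu> + 1 + z d/dz lowers the order. It multiplies the n-th
  coefficient by \<nu> + 1 + n, which is the change needed in the Pochhammer symbol.\<close>

lemma bessel_series_contiguous:
  assumes "\<nu> \<ge> - 1 / 2"
  shows "(\<nu> + 1) * bessel_series \<nu> z
       = (\<nu> + 1) * bessel_series (\<nu> + 1) z - z / (\<nu> + 2) * bessel_series (\<nu> + 2) z"
proof -
  let ?c = "\<lambda>\<nu> n. (- 1) ^ n / (fact n * pochhammer (\<nu> + 1) n) :: real"
  have S: "(\<lambda>n. ?c \<nu> n * z ^ n) sums bessel_series \<nu> z" if "\<nu> \<ge> - 1 / 2" for \<nu>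
    unfolding bessel_series_def using summable_bessel_series[OF that] by (rule summable_sums)
  have a: "(\<lambda>n. (\<nu> + 1) * (?c (\<nu> + 1) n * z ^ n)) sums ((\<nu> + 1) * bessel_series (\<nu> + 1) z)"
    using assms by (intro sums_mult S) simp
  have "(\<lambda>n. - (1 / (\<nu> + 2)) * (?c (\<nu> + 2) n * z ^ n)) sums (- (1 / (\<nu> + 2)) * bessel_series (\<nu> + 2) z)"
    using assms by (intro sums_mult S) simp
  then have d: "(\<lambda>n. diffs (?c (\<nu> + 1)) n * z ^ n) sums (- (1 / (\<nu> + 2)) * bessel_series (\<nu> + 2) z)"
    unfolding diffs_bessel_series by (simp add: add.assoc mult.assoc)
  \<comment> \<open>Multiplication by z undoes the index shift of \<open>diffs\<close>; the
    truncated exponent at n = 0 is masked by \<open>of_nat n\<close>.\<close>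
  have "(\<lambda>n. z * (of_nat n * ?c (\<nu> + 1) n * z ^ (n - Suc 0))) sums (z * (- (1 / (\<nu> + 2)) * bessel_series (\<nu> + 2) z))"
    using diffs_equiv[OF sums_summable[OF d]] sums_unique[OF d] by (intro sums_mult) simp
  from sums_add[OF a this]
  have "(\<lambda>n. (\<nu> + 1) * (?c (\<nu> + 1) n * z ^ n) + z * (of_nat n * ?c (\<nu> + 1) n * z ^ (n - Suc 0)))
      sums ((\<nu> + 1) * bessel_series (\<nu> + 1) z - z / (\<nu> + 2) * bessel_series (\<nu> + 2) z)"
    by simp
  moreover have "(\<nu> + 1) * (?c (\<nu> + 1) n * z ^ n) + z * (of_nat n * ?c (\<nu> + 1) n * z ^ (n - Suc 0))
      = (\<nu> + 1) * (?c \<nu> n * z ^ n)" for n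
  proof -
    have pos: "pochhammer (\<nu> + 1) n > 0" "pochhammer (\<nu> + 1 + 1) n > 0"
      using assms by (auto intro!: pochhammer_pos)
    \<comment> \<open>Both sides are \<open>pochhammer (\<nu> + 1) (Suc n)\<close>, with its first
      or its last factor split off.\<close>
    have p: "(\<nu> + 1) * pochhammer (\<nu> + 1 + 1) n = pochhammer (\<nu> + 1) n * (\<nu> + 1 + of_nat n)"
      by (metis pochhammer_rec pochhammer_Suc)
    have q: "(\<nu> + 1 + of_nat n) / pochhammer (\<nu> + 1 + 1) n = (\<nu> + 1) / pochhammer (\<nu> + 1) n"
      using p pos by (simp add: field_simps)
    have z: "z * (of_nat n * ?c (\<nu> + 1) n * z ^ (n - Suc 0)) = of_nat n * ?c (\<nu> + 1) n * z ^ n"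
      by (cases n) auto
    have "(\<nu> + 1) * (?c (\<nu> + 1) n * z ^ n) + of_nat n * ?c (\<nu> + 1) n * z ^ n
        = ((\<nu> + 1 + of_nat n) / pochhammer (\<nu> + 1 + 1) n) * ((- 1) ^ n / fact n * z ^ n)"
      by (simp add: add_divide_distrib algebra_simps)
    also have "\<dots> = (\<nu> + 1) * (?c \<nu> n * z ^ n)" unfolding q by simp
    finally show ?thesis unfolding z .
  qed
  ultimately have "(\<lambda>n. (\<nu> + 1) * (?c \<nu> n * z ^ n))
      sums ((\<nu> + 1) * bessel_series (\<nu> + 1) z - z / (\<nu> + 2) * bessel_series (\<nu> + 2) z)"
    by simp
  then show ?thesis using sums_mult[OF S[OF assms], of "\<nu> + 1"] sums_unique2 by blast
qed

text \<open>The even entire extension of \<open>normalized_bessel\<close>, which is meant for x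
  \<ge> 0 only. It makes sense of derivatives at 0 and of negative values of the transform
  variable.\<close>

definition bessel_entire :: "real \<Rightarrow> real \<Rightarrow> real" where
  "bessel_entire \<nu> x = bessel_series \<nu> (x\<^sup>2 / 4)"

definition bessel_entire' :: "real \<Rightarrow> real \<Rightarrow> real" where
  "bessel_entire' \<nu> x = - (x / (2 * \<nu> + 2)) * bessel_entire (\<nu> + 1) x"

lemma bessel_entire_even: "bessel_entire \<nu> (- x) = bessel_entire \<nu> x"
  by (simp add: bessel_entire_def)

lemma has_real_derivative_bessel_entire:
  assumes "\<nu> \<ge> - 1 / 2"
  shows "(bessel_entire \<nu> has_real_derivative bessel_entire' \<nu> x) (at x)"
proof -
  have "((\<lambda>x. bessel_series \<nu> (x\<^sup>2 / 4)) has_real_derivative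
      (- (1 / (\<nu> + 1)) * bessel_series (\<nu> + 1) (x\<^sup>2 / 4)) * (2 * x / 4)) (at x)"
    by (rule DERIV_chain2[OF has_real_derivative_bessel_series[OF assms]])
      (auto intro!: derivative_eq_intros)
  then show ?thesis using assms
    unfolding bessel_entire_def[abs_def] bessel_entire'_def
    by (elim DERIV_cong) (simp add: field_simps)
qed

text \<open>This is the classical rule that x^(2 \<nu> + 2) j_(\<nu> + 1) has derivative (2 \<nu> +
  2) x^(2 \<nu> + 1) j_\<nu>, divided by x^(2 \<nu> + 1) so that it is meaningful at 0.\<close>

lemma bessel_entire_contiguous:
  assumes "\<nu> \<ge> - 1 / 2"
  shows "(2 * \<nu> + 2) * bessel_entire (\<nu> + 1) x + x * bessel_entire' (\<nu> + 1) x
       = (2 * \<nu> + 2) * bessel_entire \<nu> x"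
proof -
  let ?t = "x\<^sup>2 / 4 / (\<nu> + 2)"
  have "x * (x / (2 * (\<nu> + 1) + 2)) = 2 * ?t"
    using assms by (simp add: divide_simps power2_eq_square)
  then have "x * bessel_entire' (\<nu> + 1) x = - (2 * ?t * bessel_entire (\<nu> + 2) x)"
    by (simp only: bessel_entire'_def add.assoc one_add_one mult_minus_left mult_minus_right
        mult.assoc[symmetric])
  then have "(2 * \<nu> + 2) * bessel_entire (\<nu> + 1) x + x * bessel_entire' (\<nu> + 1) x
      = 2 * ((\<nu> + 1) * bessel_entire (\<nu> + 1) x - ?t * bessel_entire (\<nu> + 2) x)"
    by (simp only: right_diff_distrib) (simp add: algebra_simps)
  also have "\<dots> = 2 * ((\<nu> + 1) * bessel_entire \<nu> x)"
    using bessel_series_contiguous[OF assms] by (simp only: bessel_entire_def)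
  finally show ?thesis by (simp add: algebra_simps)
qed

text \<open>Bessel's equation j'' + (2 \<nu> + 1) j' / x + j = 0, with j' / x replaced by its value
  - j_(\<nu> + 1) / (2 \<nu> + 2); in this form there is no singularity at 0.\<close>

lemma has_real_derivative_bessel_entire':
  assumes "\<nu> \<ge> - 1 / 2"
  shows "(bessel_entire' \<nu> has_real_derivative
      (2 * \<nu> + 1) / (2 * \<nu> + 2) * bessel_entire (\<nu> + 1) x - bessel_entire \<nu> x) (at x)"
proof -
  have "((\<lambda>x. - (x / (2 * \<nu> + 2)) * bessel_entire (\<nu> + 1) x) has_real_derivative
      - (1 / (2 * \<nu> + 2)) * bessel_entire (\<nu> + 1) x
      - (x / (2 * \<nu> + 2)) * bessel_entire' (\<nu> + 1) x) (at x)"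
    using assms by (auto intro!: derivative_eq_intros has_real_derivative_bessel_entire
        simp: add_divide_distrib)
  moreover have "- (1 / (2 * \<nu> + 2)) * bessel_entire (\<nu> + 1) x
      - (x / (2 * \<nu> + 2)) * bessel_entire' (\<nu> + 1) x
      = (2 * \<nu> + 1) / (2 * \<nu> + 2) * bessel_entire (\<nu> + 1) x - bessel_entire \<nu> x"
  proof -
    have "bessel_entire \<nu> x = bessel_entire (\<nu> + 1) x + x / (2 * \<nu> + 2) * bessel_entire' (\<nu> + 1) x"
      using bessel_entire_contiguous[OF assms, of x] assms by (simp add: divide_simps mult.commute)
    moreover have "(2 * \<nu> + 1) / (2 * \<nu> + 2) = 1 - 1 / (2 * \<nu> + 2)"
      using assms by (simp add: divide_simps)
    ultimately show ?thesis by (simp only: left_diff_distrib)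
  qed
  ultimately show ?thesis by (simp add: bessel_entire'_def[abs_def])
qed

lemma bessel_entire_0: "bessel_entire \<nu> 0 = 1"
proof -
  have "bessel_series \<nu> 0 = 1" unfolding bessel_series_def by (subst powser_zero) simp
  then show ?thesis by (simp add: bessel_entire_def)
qed

lemma bessel_entire_energy:
  assumes "\<nu> \<ge> - 1 / 2"
  shows "(bessel_entire \<nu> x)\<^sup>2 + (bessel_entire' \<nu> x)\<^sup>2 \<le> 1"
proof -
  \<comment> \<open>The derivative of \<open>?e\<close> is \<open>- 2 (2 \<nu> + 1) / x * (bessel_entire' \<nu> x)\<^sup>2\<close> by the Bessel equation.\<close>
  let ?e = "\<lambda>x. (bessel_entire \<nu> x)\<^sup>2 + (bessel_entire' \<nu> x)\<^sup>2"
  have "?e \<bar>x\<bar> \<le> ?e 0"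
  proof (rule DERIV_nonpos_imp_nonincreasing[where f = ?e])
    fix y :: real assume "0 \<le> y"
    let ?j = "bessel_entire \<nu> y" and ?j' = "bessel_entire' \<nu> y" and ?k = "bessel_entire (\<nu> + 1) y"
    let ?d = "2 * ?j * ?j' + 2 * ?j' * ((2 * \<nu> + 1) / (2 * \<nu> + 2) * ?k - ?j)"
    have "(?e has_real_derivative ?d) (at y)"
      using has_real_derivative_bessel_entire[OF assms] has_real_derivative_bessel_entire'[OF assms]
      by (auto intro!: derivative_eq_intros)
    moreover have "?d = - (2 * y * (2 * \<nu> + 1) / (2 * \<nu> + 2)\<^sup>2 * ?k\<^sup>2)"
      by (simp add: bessel_entire'_def power2_eq_square algebra_simps)
    moreover have "2 * y * (2 * \<nu> + 1) / (2 * \<nu> + 2)\<^sup>2 * ?k\<^sup>2 \<ge> 0"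
      using assms \<open>0 \<le> y\<close> by simp
    ultimately show "\<exists>d. (?e has_real_derivative d) (at y) \<and> d \<le> 0" by auto
  qed simp
  moreover have "?e \<bar>x\<bar> = ?e x"
    by (cases "x \<ge> 0") (simp_all add: bessel_entire_even bessel_entire'_def)
  ultimately show ?thesis by (simp add: bessel_entire_0 bessel_entire'_def)
qed

lemma abs_bessel_entire_le:
  assumes "\<nu> \<ge> - 1 / 2"
  shows "\<bar>bessel_entire \<nu> x\<bar> \<le> 1"
proof -
  have "(bessel_entire \<nu> x)\<^sup>2 \<le> 1"
    using bessel_entire_energy[OF assms, of x] by (smt (verit) zero_le_power2)
  then show ?thesis by (simp add: abs_square_le_1)
qed

lemma abs_bessel_entire'_le:
  assumes "\<nu> \<ge> - 1 / 2"
  shows "\<bar>bessel_entire' \<nu> x\<bar> \<le> 1"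
proof -
  have "(bessel_entire' \<nu> x)\<^sup>2 \<le> 1"
    using bessel_entire_energy[OF assms, of x] by (smt (verit) zero_le_power2)
  then show ?thesis by (simp add: abs_square_le_1)
qed

lemma bessel_entire_isCont:
  assumes "\<nu> \<ge> - 1 / 2"
  shows "isCont (bessel_entire \<nu>) x" "isCont (bessel_entire' \<nu>) x"
  using has_real_derivative_bessel_entire[OF assms] has_real_derivative_bessel_entire'[OF assms]
    DERIV_isCont by blast+

lemma continuous_on_bessel_entire [continuous_intros]:
  fixes h :: "'a::topological_space \<Rightarrow> real"
  assumes "\<nu> \<ge> - 1 / 2" "continuous_on S h"
  shows "continuous_on S (\<lambda>x. bessel_entire \<nu> (h x))" "continuous_on S (\<lambda>x. bessel_entire' \<nu> (h x))"
  by (rule continuous_on_compose2[OF continuous_at_imp_continuous_on assms(2)];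
      use bessel_entire_isCont[OF assms(1)] in auto)+

text \<open>In the formula for j'' the coefficient has absolute value at most 1 and so do both
  Bessel functions, which gives the constant 2 = 1 + 1 for all orders.\<close>

lemma bessel_entire'_lipschitz:
  assumes "\<nu> \<ge> - 1 / 2"
  shows "\<bar>bessel_entire' \<nu> y - bessel_entire' \<nu> x\<bar> \<le> 2 * \<bar>y - x\<bar>"
proof -
  let ?d = "\<lambda>x. (2 * \<nu> + 1) / (2 * \<nu> + 2) * bessel_entire (\<nu> + 1) x - bessel_entire \<nu> x"
  have "norm (?d z) \<le> 2" for z
  proof -
    have "\<bar>(2 * \<nu> + 1) / (2 * \<nu> + 2)\<bar> \<le> 1" using assms by (simp add: field_simps)
    moreover have "\<bar>bessel_entire (\<nu> + 1) z\<bar> \<le> 1" "\<bar>bessel_entire \<nu> z\<bar> \<le> 1"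
      using assms by (auto intro!: abs_bessel_entire_le)
    ultimately have "\<bar>(2 * \<nu> + 1) / (2 * \<nu> + 2)\<bar> * \<bar>bessel_entire (\<nu> + 1) z\<bar> \<le> 1 * 1"
      by (intro mult_mono) auto
    then have "\<bar>(2 * \<nu> + 1) / (2 * \<nu> + 2) * bessel_entire (\<nu> + 1) z\<bar> \<le> 1" by (simp only: abs_mult)
    with \<open>\<bar>bessel_entire \<nu> z\<bar> \<le> 1\<close> show ?thesis unfolding real_norm_def by linarith
  qed
  then show ?thesis
    using field_differentiable_bound[of UNIV "bessel_entire' \<nu>" ?d 2 y x]
      has_real_derivative_bessel_entire'[OF assms]
    by (auto simp: real_norm_def)
qed

text \<open>The mean value theorem combined with the Lipschitz bound on j'. That the constant
  depends neither on x nor on y is what later permits integrating the estimate in order to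
  differentiate a transform.\<close>

lemma bessel_entire_taylor:
  assumes "\<nu> \<ge> - 1 / 2"
  shows "\<bar>bessel_entire \<nu> y - bessel_entire \<nu> x - (y - x) * bessel_entire' \<nu> x\<bar> \<le> 2 * (y - x)\<^sup>2"
proof -
  have "\<exists>z. \<bar>z - x\<bar> \<le> \<bar>y - x\<bar> \<and> bessel_entire \<nu> y - bessel_entire \<nu> x = (y - x) * bessel_entire' \<nu> z"
  proof (cases x y rule: linorder_cases)
    case less
    from MVT2[OF less has_real_derivative_bessel_entire[OF assms]]
    obtain z where "x < z" "z < y"
      "bessel_entire \<nu> y - bessel_entire \<nu> x = (y - x) * bessel_entire' \<nu> z" by blast
    then show ?thesis by (intro exI[of _ z]) auto
  next
    case greater
    from MVT2[OF greater has_real_derivative_bessel_entire[OF assms]]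
    obtain z where "y < z" "z < x"
      "bessel_entire \<nu> x - bessel_entire \<nu> y = (x - y) * bessel_entire' \<nu> z" by blast
    then show ?thesis by (intro exI[of _ z]) (auto simp: algebra_simps)
  qed auto
  then obtain z where z: "\<bar>z - x\<bar> \<le> \<bar>y - x\<bar>"
    "bessel_entire \<nu> y - bessel_entire \<nu> x = (y - x) * bessel_entire' \<nu> z" by blast
  have "\<bar>bessel_entire \<nu> y - bessel_entire \<nu> x - (y - x) * bessel_entire' \<nu> x\<bar>
      = \<bar>y - x\<bar> * \<bar>bessel_entire' \<nu> z - bessel_entire' \<nu> x\<bar>"
    unfolding z(2) by (simp only: right_diff_distrib[symmetric] abs_mult)
  also have "\<dots> \<le> \<bar>y - x\<bar> * (2 * \<bar>y - x\<bar>)"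
    using bessel_entire'_lipschitz[OF assms, of z x] z(1) by (intro mult_left_mono) auto
  also have "\<dots> = 2 * (y - x)\<^sup>2" by (simp add: power2_eq_square)
  finally show ?thesis .
qed

text \<open>Gamma (\<nu> + n + 1) is Gamma (\<nu> + 1) times a Pochhammer symbol; the prefactors 2
  powr \<nu>, x powr (- \<nu>) and (x / 2) powr \<nu> then cancel for x > 0.\<close>

lemma normalized_bessel_eq:
  assumes "\<nu> \<ge> - 1 / 2" "x \<ge> 0"
  shows "normalized_bessel \<nu> x = bessel_entire \<nu> x"
proof (cases "x = 0")
  case True
  then show ?thesis by (simp add: normalized_bessel_def bessel_entire_0)
next
  case False
  with assms have x: "x > 0" by simp
  have G: "Gamma (\<nu> + 1) > 0" using assms by (intro Gamma_real_pos) auto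
  have "\<nu> + 1 \<notin> \<int>\<^sub>\<le>\<^sub>0" using assms by (auto elim!: nonpos_Ints_cases)
  then have p: "Gamma (\<nu> + real n + 1) = Gamma (\<nu> + 1) * pochhammer (\<nu> + 1) n" for n
    using G by (simp add: pochhammer_Gamma add_ac)
  have "(\<lambda>n. (- 1) ^ n / (fact n * pochhammer (\<nu> + 1) n) * (x\<^sup>2 / 4) ^ n) sums bessel_entire \<nu> x"
    unfolding bessel_entire_def bessel_series_def
    by (intro summable_sums summable_bessel_series assms)
  then have "(\<lambda>n. (1 / Gamma (\<nu> + 1)) * ((- 1) ^ n / (fact n * pochhammer (\<nu> + 1) n) * (x\<^sup>2 / 4) ^ n))
      sums ((1 / Gamma (\<nu> + 1)) * bessel_entire \<nu> x)"
    by (rule sums_mult)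
  moreover have "(1 / Gamma (\<nu> + 1)) * ((- 1) ^ n / (fact n * pochhammer (\<nu> + 1) n) * (x\<^sup>2 / 4) ^ n)
      = (- 1) ^ n / (fact n * Gamma (\<nu> + real n + 1)) * (x / 2) ^ (2 * n)" for n
  proof -
    have "(x\<^sup>2 / 4) ^ n = (x / 2) ^ (2 * n)" by (simp add: power_mult power_divide)
    then show ?thesis unfolding p by simp
  qed
  ultimately have "(\<lambda>n. (- 1) ^ n / (fact n * Gamma (\<nu> + real n + 1)) * (x / 2) ^ (2 * n))
      sums (bessel_entire \<nu> x / Gamma (\<nu> + 1))"
    by simp
  then have "(\<Sum>n. (- 1) ^ n / (fact n * Gamma (\<nu> + real n + 1)) * (x / 2) ^ (2 * n))
      = bessel_entire \<nu> x / Gamma (\<nu> + 1)"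
    by (rule sums_unique[symmetric])
  then show ?thesis
    using x G by (simp add: normalized_bessel_def bessel_J_def powr_divide powr_minus field_simps)
qed


subsection \<open>Hankel transforms of even Schwartz functions\<close>

lemma set_borel_measurable_continuous_on:
  fixes f :: "real \<Rightarrow> 'a::real_normed_vector"
  assumes "A \<in> sets borel" "continuous_on A f"
  shows "set_borel_measurable lborel A f"
  using borel_measurable_continuous_on_indicator[OF assms] by (simp add: set_borel_measurable_def)

text \<open>A bridge from gauge integrals, for which the integrals of powers are known, to
  \<open>lborel\<close>: for nonnegative functions integrability is absolute, and continuity
  supplies Borel measurability.\<close>

lemma set_integrable_lborel_nonneg:
  fixes f :: "real \<Rightarrow> real"
  assumes "f integrable_on A" "\<And>x. x \<in> A \<Longrightarrow> 0 \<le> f x" "A \<in> sets borel" "continuous_on A f"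
  shows "set_integrable lborel A f"
proof -
  have "f absolutely_integrable_on A"
    using assms(1,2) by (subst absolutely_integrable_on_iff_nonneg) auto
  moreover have "(\<lambda>x. indicat_real A x *\<^sub>R f x) \<in> borel_measurable lborel"
    using borel_measurable_continuous_on_indicator[OF assms(3,4)] by simp
  ultimately show ?thesis unfolding set_integrable_def by (simp add: integrable_completion)
qed

lemma powr_le_power:
  fixes x :: real
  assumes "x \<ge> 1"
  shows "x powr p \<le> x ^ nat \<lceil>p\<rceil>"
proof -
  have "x powr p \<le> x powr real (nat \<lceil>p\<rceil>)"
    using assms by (intro powr_mono) linarith+
  then show ?thesis using assms by (simp add: powr_realpow)
qed

text \<open>Near 0 the majorant is a multiple of \<open>x powr \<alpha>\<close>, integrable because
  \<alpha> > - 1; from 1 on it is a multiple of \<open>x powr - 2\<close>.\<close>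

lemma set_integrable_powr_rapid:
  fixes \<phi> :: "real \<Rightarrow> complex"
  assumes \<alpha>: "\<alpha> > - 1" and cont: "continuous_on {0<..} \<phi>"
    and rapid: "\<And>m. \<exists>K. \<forall>x>0. x ^ m * norm (\<phi> x) \<le> K"
  shows "set_integrable lborel {0<..} (\<lambda>x. x powr \<alpha> *\<^sub>R \<phi> x)"
proof -
  have cp: "continuous_on {0<..} (\<lambda>x::real. x powr p)" for p
    by (intro continuous_intros) auto
  have c: "continuous_on {0<..} (\<lambda>x. x powr \<alpha> *\<^sub>R \<phi> x)"
    by (intro continuous_intros cont cp)
  obtain K where K: "norm (\<phi> x) \<le> K" if "x > 0" for x using rapid[of 0] by auto
  \<comment> \<open>Large enough that \<open>x powr (\<alpha> + 2) \<le> x ^ m\<close> for x \<ge>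
    1, which leaves \<open>x powr - 2\<close> to integrate.\<close>
  define m where "m = nat \<lceil>\<alpha> + 2\<rceil>"
  obtain L where L: "x ^ m * norm (\<phi> x) \<le> L" if "x > 0" for x using rapid[of m] by auto
  have "set_integrable lborel {0<..1} (\<lambda>x. x powr \<alpha> *\<^sub>R \<phi> x)"
  proof (rule set_integrable_bound)
    have "set_integrable lborel {0<..1::real} (\<lambda>x. x powr \<alpha>)"
      by (intro set_integrable_lborel_nonneg integrable_on_powr_from_0' \<alpha> continuous_on_subset[OF cp]) auto
    then show "set_integrable lborel {0<..1::real} (\<lambda>x. K * x powr \<alpha>)"
      by simp
    show "set_borel_measurable lborel {0<..1} (\<lambda>x. x powr \<alpha> *\<^sub>R \<phi> x)"
      by (intro set_borel_measurable_continuous_on continuous_on_subset[OF c]) auto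
    show "AE x in lborel. x \<in> {0<..1} \<longrightarrow> norm (x powr \<alpha> *\<^sub>R \<phi> x) \<le> norm (K * x powr \<alpha>)"
    proof (intro AE_I2 impI)
      fix x :: real assume "x \<in> {0<..1}"
      then have "norm (\<phi> x) \<le> \<bar>K\<bar>" using K[of x] by auto
      then show "norm (x powr \<alpha> *\<^sub>R \<phi> x) \<le> norm (K * x powr \<alpha>)"
        by (simp add: abs_mult mult.commute mult_right_mono)
    qed
  qed
  moreover have "set_integrable lborel {1..} (\<lambda>x. x powr \<alpha> *\<^sub>R \<phi> x)"
  proof (rule set_integrable_bound)
    have "set_integrable lborel {1::real..} (\<lambda>x. x powr - 2)"
      using has_integral_powr_to_inf[of "- 2" 1]
      by (intro set_integrable_lborel_nonneg continuous_on_subset[OF cp]) (auto simp: integrable_on_def)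
    then show "set_integrable lborel {1::real..} (\<lambda>x. L * x powr - 2)"
      by simp
    show "set_borel_measurable lborel {1..} (\<lambda>x. x powr \<alpha> *\<^sub>R \<phi> x)"
      by (intro set_borel_measurable_continuous_on continuous_on_subset[OF c]) auto
    show "AE x in lborel. x \<in> {1..} \<longrightarrow> norm (x powr \<alpha> *\<^sub>R \<phi> x) \<le> norm (L * x powr - 2)"
    proof (intro AE_I2 impI)
      fix x :: real assume "x \<in> {1..}"
      then have x: "x \<ge> 1" by simp
      have "x powr \<alpha> = x powr (\<alpha> + 2) * x powr - 2" by (simp add: powr_add[symmetric])
      also have "\<dots> \<le> x ^ m * x powr - 2"
        unfolding m_def by (intro mult_right_mono powr_le_power x) auto
      finally have "norm (x powr \<alpha> *\<^sub>R \<phi> x) \<le> (x ^ m * x powr - 2) * norm (\<phi> x)"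
        by (simp add: mult_right_mono)
      also have "\<dots> = (x ^ m * norm (\<phi> x)) * x powr - 2" by (simp only: mult_ac)
      also have "\<dots> \<le> L * x powr - 2" using L[of x] x by (intro mult_right_mono) auto
      also have "\<dots> \<le> norm (L * x powr - 2)" by simp
      finally show "norm (x powr \<alpha> *\<^sub>R \<phi> x) \<le> norm (L * x powr - 2)" .
    qed
  qed
  ultimately have "set_integrable lborel ({0<..1} \<union> {1..}) (\<lambda>x. x powr \<alpha> *\<^sub>R \<phi> x)"
    by (intro set_integrable_Un) auto
  moreover have "{0<..1} \<union> {1..} = {0::real<..}" by auto
  ultimately show ?thesis by simp
qed

lemma powr_eq_times:
  fixes t :: real
  assumes "t > 0" "q = p + 1"
  shows "t powr q = t powr p * t"
  using assms by (simp add: powr_add)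

lemma continuous_on_schwartz:
  assumes "g \<in> schwartz" "continuous_on A h"
  shows "continuous_on A (\<lambda>x. g (h x))"
  by (rule continuous_on_compose2[OF continuous_at_imp_continuous_on assms(2)])
    (use schwartz_isCont[OF assms(1)] in auto)

lemma set_integrable_powr_schwartz:
  fixes h :: "real \<Rightarrow> real"
  assumes "p > - 1" "continuous_on {0<..} h" "\<And>t. \<bar>h t\<bar> \<le> M" "g \<in> schwartz"
  shows "set_integrable lborel {0<..} (\<lambda>t. (t powr p * h t) *\<^sub>R g t)"
proof -
  have "set_integrable lborel {0<..} (\<lambda>t. t powr p *\<^sub>R (h t *\<^sub>R g t))"
  proof (rule set_integrable_powr_rapid)
    show "continuous_on {0<..} (\<lambda>t. h t *\<^sub>R g t)"
      by (intro continuous_intros continuous_on_schwartz assms)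
    fix m
    obtain K where K: "K \<ge> 0" "\<And>x. \<bar>x\<bar> ^ m * norm (g x) \<le> K"
      using schwartz_rapidly_decreasing[OF assms(4)] by (rule rapidly_decreasingE) blast
    have "x ^ m * norm (h x *\<^sub>R g x) \<le> M * K" if "x > 0" for x
    proof -
      have "\<bar>h x\<bar> * (\<bar>x\<bar> ^ m * norm (g x)) \<le> M * K"
        using assms(3)[of x] by (intro mult_mono K) auto
      then show ?thesis using that by (simp add: mult_ac)
    qed
    then show "\<exists>K. \<forall>x>0. x ^ m * norm (h x *\<^sub>R g x) \<le> K" by blast
  qed (use assms in simp)
  then show ?thesis by simp
qed

text \<open>The integrand is the derivative of \<open>F\<close>, the product of all three factors.
  \<open>F\<close> tends to 0 at 0 because of the power, and at infinity because \<open>g\<close>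
  decays rapidly.\<close>

lemma set_integral_powr_by_parts:
  fixes h h' :: "real \<Rightarrow> real"
  assumes p: "p \<ge> 1"
    and dh: "\<And>t. (h has_real_derivative h' t) (at t)" and ch': "continuous_on UNIV h'"
    and M: "\<And>t. \<bar>h t\<bar> \<le> M" "\<And>t. \<bar>h' t\<bar> \<le> M'"
    and g: "g \<in> schwartz" "g' \<in> schwartz" and dg: "\<And>t. (g has_vector_derivative g' t) (at t)"
  shows "(LINT t:{0<..}|lborel. (p * t powr (p - 1) * h t + t powr p * h' t) *\<^sub>R g t
            + (t powr p * h t) *\<^sub>R g' t) = 0" (is "(LINT t:_|_. ?f t) = 0")
proof -
  define F where "F t = (t powr p * h t) *\<^sub>R g t" for t
  have M0: "M \<ge> 0" using M(1)[of 0] by linarith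
  have ch: "continuous_on A h" for A
    using dh DERIV_isCont by (intro continuous_at_imp_continuous_on) blast
  have ch'': "continuous_on A h'" for A using ch' continuous_on_subset by blast
  have cg: "continuous_on A g" "continuous_on A g'" for A
    using g schwartz_isCont by (auto intro!: continuous_at_imp_continuous_on)
  have cf: "continuous_on {0<..} ?f"
    by (intro continuous_intros ch ch'' cg) auto
  have "(LBINT t=0..\<infinity>. ?f t) = 0 - 0"
  proof (rule interval_integral_FTC_integrable[where F = F])
    fix t :: real assume t: "0 < ereal t"
    have "((\<lambda>t. t powr p * h t) has_real_derivative p * t powr (p - 1) * h t + t powr p * h' t) (at t)"
      using t by (auto intro!: derivative_eq_intros dh)
    from has_vector_derivative_scaleR[OF this dg[of t]]
    show "(F has_vector_derivative ?f t) (at t)"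
      by (simp add: F_def[abs_def] add.commute)
    show "isCont ?f t"
      using cf t by (simp add: continuous_on_eq_continuous_at)
  next
    have "set_integrable lborel {0<..} (\<lambda>t. (t powr (p - 1) * (p * h t)) *\<^sub>R g t)"
    proof (rule set_integrable_powr_schwartz[where M = "p * M"])
      show "\<bar>p * h t\<bar> \<le> p * M" for t using M(1)[of t] p by (simp add: abs_mult)
    qed (use p g in \<open>auto intro!: continuous_intros ch\<close>)
    moreover have "set_integrable lborel {0<..} (\<lambda>t. (t powr p * h' t) *\<^sub>R g t)"
      by (rule set_integrable_powr_schwartz[OF _ _ M(2)]) (use p g ch'' in auto)
    moreover have "set_integrable lborel {0<..} (\<lambda>t. (t powr p * h t) *\<^sub>R g' t)"
      by (rule set_integrable_powr_schwartz[OF _ _ M(1)]) (use p g ch in auto)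
    ultimately have "set_integrable lborel {0<..} (\<lambda>t. (t powr (p - 1) * (p * h t)) *\<^sub>R g t
       + (t powr p * h' t) *\<^sub>R g t + (t powr p * h t) *\<^sub>R g' t)"
      by (intro set_integral_add)
    then show "set_integrable lborel (einterval 0 \<infinity>) ?f"
      by (simp add: zero_ereal_def scaleR_add_left mult_ac)
  next
    obtain K where K: "K \<ge> 0" "\<And>x. \<bar>x\<bar> ^ 0 * norm (g x) \<le> K"
      using schwartz_rapidly_decreasing[OF g(1)] by (rule rapidly_decreasingE) blast
    have bound: "norm (F t) \<le> t powr p * (M * K)" for t
    proof -
      have "\<bar>h t\<bar> * norm (g t) \<le> M * K"
        using M(1)[of t] K(2)[of t] M0 by (intro mult_mono) auto
      then show ?thesis by (simp add: F_def abs_mult mult.assoc mult_left_mono)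
    qed
    have "((\<lambda>t::real. t powr p) \<longlongrightarrow> 0 powr p) (at_right 0)"
      using p by (intro tendsto_powr' tendsto_intros) (auto simp: eventually_at_right_less eventually_at_topological intro!: exI[of _ UNIV])
    then have "((\<lambda>t::real. t powr p * (M * K)) \<longlongrightarrow> 0) (at_right 0)"
      using tendsto_mult_left_zero by fastforce
    then have "(F \<longlongrightarrow> 0) (at_right 0)"
      using bound by (intro Lim_null_comparison[of F "\<lambda>t. t powr p * (M * K)"] always_eventually) auto
    then show "((F \<circ> real_of_ereal) \<longlongrightarrow> 0) (at_right 0)"
      by (simp add: zero_ereal_def ereal_tendsto_simps)
  next
    define m where "m = nat \<lceil>p\<rceil>"
    \<comment> \<open>One power more than is needed to absorb \<open>t powr p\<close>, so that
      \<open>F\<close> is bounded by a multiple of 1 / t.\<close>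
    obtain K where K: "K \<ge> 0" "\<And>x. \<bar>x\<bar> ^ Suc m * norm (g x) \<le> K"
      using schwartz_rapidly_decreasing[OF g(1)] by (rule rapidly_decreasingE) blast
    have bound: "norm (F t) \<le> (M * K) * inverse t" if t: "t \<ge> 1" for t
    proof -
      have "norm (F t) = \<bar>h t\<bar> * (t powr p * norm (g t))"
        by (simp add: F_def abs_mult)
      also have "\<dots> \<le> M * (t ^ m * norm (g t))"
        unfolding m_def using M(1)[of t] powr_le_power[OF t, of p] t
        by (intro mult_mono) auto
      also have "t ^ m * norm (g t) = (\<bar>t\<bar> ^ Suc m * norm (g t)) * inverse t"
        using t by simp
      also have "M * \<dots> \<le> M * (K * inverse t)"
        using t M0 K(2)[of t] by (intro mult_left_mono mult_right_mono) auto
      finally show ?thesis by simp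
    qed
    have "((\<lambda>t::real. (M * K) * inverse t) \<longlongrightarrow> 0) at_top"
      by (intro tendsto_mult_right_zero tendsto_inverse_0_at_top filterlim_ident)
    then have "(F \<longlongrightarrow> 0) at_top"
      by (rule Lim_null_comparison[rotated]) (use bound in \<open>auto intro!: eventually_at_top_linorderI[of 1]\<close>)
    then show "((F \<circ> real_of_ereal) \<longlongrightarrow> 0) (at_left \<infinity>)"
      by (simp add: ereal_tendsto_simps)
  qed simp
  then show ?thesis by (simp add: interval_lebesgue_integral_0_infty)
qed

section \<open>The transform and its two order-changing relations\<close>

text \<open>The scale \<open>c\<close> stands for the 2 / a in the argument of the kernel. Below it
  matters only that it is positive, so it is kept apart from the exponent N of the
  substitution.\<close>

definition hankel :: "real \<Rightarrow> real \<Rightarrow> (real \<Rightarrow> complex) \<Rightarrow> real \<Rightarrow> complex" where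
  "hankel c \<nu> g u = (LINT t:{0<..}|lborel. (t powr (2 * \<nu> + 1) * bessel_entire \<nu> (c * t * u)) *\<^sub>R g t)"

definition even_schwartz :: "(real \<Rightarrow> complex) set" where
  "even_schwartz = {g \<in> schwartz. \<forall>t. g (- t) = g t}"

lemma hankel_even: "hankel c \<nu> g (- u) = hankel c \<nu> g u"
  by (simp add: hankel_def bessel_entire_even)

lemma set_integrable_hankel:
  assumes "\<nu> \<ge> - 1 / 2" "g \<in> schwartz"
  shows "set_integrable lborel {0<..} (\<lambda>t. (t powr (2 * \<nu> + 1) * bessel_entire \<nu> (c * t * u)) *\<^sub>R g t)"
  by (rule set_integrable_powr_schwartz[OF _ _ abs_bessel_entire_le])
    (use assms in \<open>auto intro!: continuous_intros\<close>)

lemma norm_hankel_le: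
  assumes "\<nu> \<ge> - 1 / 2" "g \<in> schwartz"
  shows "norm (hankel c \<nu> g u) \<le> (LINT t:{0<..}|lborel. norm (t powr (2 * \<nu> + 1) *\<^sub>R g t))"
proof -
  have i: "set_integrable lborel {0<..} (\<lambda>t. (t powr (2 * \<nu> + 1) * 1) *\<^sub>R g t)"
    by (rule set_integrable_powr_schwartz[where M = 1]) (use assms in auto)
  have "norm (hankel c \<nu> g u)
      \<le> (LINT t:{0<..}|lborel. norm ((t powr (2 * \<nu> + 1) * bessel_entire \<nu> (c * t * u)) *\<^sub>R g t))"
    unfolding hankel_def by (intro set_integral_norm_bound set_integrable_hankel assms)
  also have "\<dots> \<le> (LINT t:{0<..}|lborel. norm (t powr (2 * \<nu> + 1) *\<^sub>R g t))"
  proof (rule set_integral_mono)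
    fix t :: real
    have "\<bar>bessel_entire \<nu> (c * t * u)\<bar> * (t powr (2 * \<nu> + 1) * norm (g t))
        \<le> 1 * (t powr (2 * \<nu> + 1) * norm (g t))"
      using assms by (intro mult_right_mono abs_bessel_entire_le) auto
    then show "norm ((t powr (2 * \<nu> + 1) * bessel_entire \<nu> (c * t * u)) *\<^sub>R g t)
        \<le> norm (t powr (2 * \<nu> + 1) *\<^sub>R g t)"
      by (simp add: abs_mult mult_ac)
  qed (use set_integrable_norm[OF set_integrable_hankel[OF assms]] set_integrable_norm[OF i] in simp_all)
  finally show ?thesis .
qed

lemma DERIV_bessel_entire_scaled:
  assumes "\<nu> \<ge> - 1 / 2"
  shows "((\<lambda>t. bessel_entire \<nu> (c * t * u)) has_real_derivative (c * u) * bessel_entire' \<nu> (c * t * u)) (at t)"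
proof -
  have "((\<lambda>t. c * t * u) has_real_derivative c * u) (at t)"
    by (auto intro!: derivative_eq_intros)
  from DERIV_chain2[OF has_real_derivative_bessel_entire[OF assms] this] show ?thesis
    by (rule DERIV_cong) (rule mult.commute)
qed

text \<open>Weight and Bessel function carry separate orders \<nu> and \<mu>: the choice \<mu> =
  \<nu> + 1 serves to raise the order of the transform, \<mu> = \<nu> to lower it.\<close>

lemma hankel_by_parts:
  assumes "\<nu> \<ge> - 1 / 2" "g \<in> schwartz" "g' \<in> schwartz" "\<And>t. (g has_vector_derivative g' t) (at t)"
    and \<mu>: "\<mu> \<ge> - 1 / 2"
  shows "(LINT t:{0<..}|lborel. (t powr (2 * \<nu> + 1) *
             ((2 * \<nu> + 2) * bessel_entire \<mu> (c * t * u) + c * t * u * bessel_entire' \<mu> (c * t * u))) *\<^sub>R g t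
            + (t powr (2 * \<nu> + 2) * bessel_entire \<mu> (c * t * u)) *\<^sub>R g' t) = 0"
proof -
  have "(LINT t:{0<..}|lborel. ((2 * \<nu> + 2) * t powr ((2 * \<nu> + 2) - 1) * bessel_entire \<mu> (c * t * u)
        + t powr (2 * \<nu> + 2) * ((c * u) * bessel_entire' \<mu> (c * t * u))) *\<^sub>R g t
        + (t powr (2 * \<nu> + 2) * bessel_entire \<mu> (c * t * u)) *\<^sub>R g' t) = 0"
  proof (rule set_integral_powr_by_parts)
    show "\<bar>(c * u) * bessel_entire' \<mu> (c * t * u)\<bar> \<le> \<bar>c * u\<bar>" for t
      using mult_left_mono[OF abs_bessel_entire'_le[OF \<mu>, of "c * t * u"] abs_ge_zero[of "c * u"]]
      by (simp only: abs_mult)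
  qed (use assms \<mu> in \<open>auto intro!: DERIV_bessel_entire_scaled abs_bessel_entire_le continuous_intros\<close>)
  moreover have "(t powr (2 * \<nu> + 1) *
         ((2 * \<nu> + 2) * bessel_entire \<mu> (c * t * u) + c * t * u * bessel_entire' \<mu> (c * t * u)))
      = ((2 * \<nu> + 2) * t powr ((2 * \<nu> + 2) - 1) * bessel_entire \<mu> (c * t * u)
        + t powr (2 * \<nu> + 2) * ((c * u) * bessel_entire' \<mu> (c * t * u)))" if "t > 0" for t
  proof -
    have a: "t powr (2 * \<nu> + 2) = t powr (2 * \<nu> + 1) * t"
      using that by (rule powr_eq_times) simp
    have b: "(2 * \<nu> + 2) - 1 = 2 * \<nu> + 1" by simp
    show ?thesis unfolding a b by (simp only: algebra_simps)
  qed
  ultimately show ?thesis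
    by (subst set_lebesgue_integral_cong) auto
qed

text \<open>With \<mu> = \<nu> + 1 the contiguous relation collapses the bracket to a multiple of
  j_\<nu>, while the factor t in g' = t q completes the weight of order \<nu> + 1.\<close>

lemma hankel_raise_order:
  assumes \<nu>: "\<nu> \<ge> - 1 / 2" and "g \<in> schwartz" "q \<in> schwartz" "(\<lambda>t. of_real t * q t) \<in> schwartz"
    and "\<And>t. (g has_vector_derivative of_real t * q t) (at t)"
  shows "(2 * \<nu> + 2) *\<^sub>R hankel c \<nu> g u + hankel c (\<nu> + 1) q u = 0"
proof -
  have \<nu>1: "\<nu> + 1 \<ge> - 1 / 2" using \<nu> by simp
  have "0 = (LINT t:{0<..}|lborel. (2 * \<nu> + 2) *\<^sub>R ((t powr (2 * \<nu> + 1) * bessel_entire \<nu> (c * t * u)) *\<^sub>R g t)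
      + (t powr (2 * (\<nu> + 1) + 1) * bessel_entire (\<nu> + 1) (c * t * u)) *\<^sub>R q t)"
  proof (subst hankel_by_parts[OF assms(1,2,4,5), of "\<nu> + 1" c u, symmetric])
    show "- 1 / 2 \<le> \<nu> + 1" by (rule \<nu>1)
  next
    have "(t powr (2 * \<nu> + 1) * ((2 * \<nu> + 2) * bessel_entire (\<nu> + 1) (c * t * u)
           + c * t * u * bessel_entire' (\<nu> + 1) (c * t * u))) *\<^sub>R g t
        + (t powr (2 * \<nu> + 2) * bessel_entire (\<nu> + 1) (c * t * u)) *\<^sub>R (of_real t * q t)
      = (2 * \<nu> + 2) *\<^sub>R ((t powr (2 * \<nu> + 1) * bessel_entire \<nu> (c * t * u)) *\<^sub>R g t)
        + (t powr (2 * (\<nu> + 1) + 1) * bessel_entire (\<nu> + 1) (c * t * u)) *\<^sub>R q t" if "t > 0" for t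
    proof -
      have "t powr (2 * (\<nu> + 1) + 1) = t powr (2 * \<nu> + 2) * t"
        using that by (rule powr_eq_times) simp
      then show ?thesis
        unfolding bessel_entire_contiguous[OF \<nu>] by (simp add: scaleR_conv_of_real mult_ac)
    qed
    then show "(LINT t:{0<..}|lborel. (t powr (2 * \<nu> + 1) * ((2 * \<nu> + 2) * bessel_entire (\<nu> + 1) (c * t * u)
           + c * t * u * bessel_entire' (\<nu> + 1) (c * t * u))) *\<^sub>R g t
        + (t powr (2 * \<nu> + 2) * bessel_entire (\<nu> + 1) (c * t * u)) *\<^sub>R (of_real t * q t))
      = (LINT t:{0<..}|lborel. (2 * \<nu> + 2) *\<^sub>R ((t powr (2 * \<nu> + 1) * bessel_entire \<nu> (c * t * u)) *\<^sub>R g t)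
        + (t powr (2 * (\<nu> + 1) + 1) * bessel_entire (\<nu> + 1) (c * t * u)) *\<^sub>R q t)"
      by (intro set_lebesgue_integral_cong) auto
  qed
  also have "\<dots> = (2 * \<nu> + 2) *\<^sub>R hankel c \<nu> g u + hankel c (\<nu> + 1) q u"
    unfolding hankel_def
    by (subst set_integral_add(2)[OF set_integrable_scaleR_right])
      (use \<nu> in \<open>simp_all only: set_integral_scaleR_right set_integrable_hankel assms(2,3) \<nu>1\<close>)
  finally show ?thesis by simp
qed

text \<open>Integration by parts with \<mu> = \<nu>. Rewriting j_\<nu>' through j_(\<nu> + 1) yields
  a further factor c t u, so the term acquires (c u)^2 and the weight of order \<nu> + 1.\<close>

lemma hankel_lower_order:
  assumes \<nu>: "\<nu> \<ge> - 1 / 2" and "q \<in> schwartz" "q' \<in> schwartz" "(\<lambda>t. of_real t * q' t) \<in> schwartz"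
    and "\<And>t. (q has_vector_derivative q' t) (at t)"
  shows "hankel c \<nu> (\<lambda>t. of_real (2 * \<nu> + 2) * q t + of_real t * q' t) u
       = ((c * u)\<^sup>2 / (2 * \<nu> + 2)) *\<^sub>R hankel c (\<nu> + 1) q u"
proof -
  let ?r = "\<lambda>t. of_real (2 * \<nu> + 2) * q t + of_real t * q' t"
  have \<nu>1: "\<nu> + 1 \<ge> - 1 / 2" using \<nu> by simp
  have r: "?r \<in> schwartz" by (intro schwartz_add schwartz_cmult assms)
  have "0 = (LINT t:{0<..}|lborel. (t powr (2 * \<nu> + 1) * bessel_entire \<nu> (c * t * u)) *\<^sub>R ?r t
      - ((c * u)\<^sup>2 / (2 * \<nu> + 2)) *\<^sub>R ((t powr (2 * (\<nu> + 1) + 1) * bessel_entire (\<nu> + 1) (c * t * u)) *\<^sub>R q t))"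
  proof (subst hankel_by_parts[OF assms(1,2,3,5), of \<nu> c u, symmetric])
    have "(t powr (2 * \<nu> + 1) * ((2 * \<nu> + 2) * bessel_entire \<nu> (c * t * u)
           + c * t * u * bessel_entire' \<nu> (c * t * u))) *\<^sub>R q t
        + (t powr (2 * \<nu> + 2) * bessel_entire \<nu> (c * t * u)) *\<^sub>R q' t
      = (t powr (2 * \<nu> + 1) * bessel_entire \<nu> (c * t * u)) *\<^sub>R ?r t
      - ((c * u)\<^sup>2 / (2 * \<nu> + 2)) *\<^sub>R ((t powr (2 * (\<nu> + 1) + 1) * bessel_entire (\<nu> + 1) (c * t * u)) *\<^sub>R q t)"
      if "t > 0" for t
    proof -
      have 1: "t powr (2 * \<nu> + 2) = t powr (2 * \<nu> + 1) * t"
        using that by (rule powr_eq_times) simp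
      have 2: "t powr (2 * (\<nu> + 1) + 1) = t powr (2 * \<nu> + 1) * t * t"
        unfolding 1[symmetric] using that by (rule powr_eq_times) simp
      have 3: "c * t * u * bessel_entire' \<nu> (c * t * u)
          = - ((c * u)\<^sup>2 / (2 * \<nu> + 2) * t * t * bessel_entire (\<nu> + 1) (c * t * u))"
        by (simp add: bessel_entire'_def power2_eq_square mult_ac)
      show ?thesis unfolding 1 2 3
        by (simp add: scaleR_conv_of_real algebra_simps)
    qed
    then show "(LINT t:{0<..}|lborel. (t powr (2 * \<nu> + 1) * ((2 * \<nu> + 2) * bessel_entire \<nu> (c * t * u)
           + c * t * u * bessel_entire' \<nu> (c * t * u))) *\<^sub>R q t
        + (t powr (2 * \<nu> + 2) * bessel_entire \<nu> (c * t * u)) *\<^sub>R q' t)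
      = (LINT t:{0<..}|lborel. (t powr (2 * \<nu> + 1) * bessel_entire \<nu> (c * t * u)) *\<^sub>R ?r t
      - ((c * u)\<^sup>2 / (2 * \<nu> + 2)) *\<^sub>R ((t powr (2 * (\<nu> + 1) + 1) * bessel_entire (\<nu> + 1) (c * t * u)) *\<^sub>R q t))"
      by (intro set_lebesgue_integral_cong) auto
  qed (use \<nu> in simp)
  also have "\<dots> = hankel c \<nu> ?r u - ((c * u)\<^sup>2 / (2 * \<nu> + 2)) *\<^sub>R hankel c (\<nu> + 1) q u"
    unfolding hankel_def
    by (subst set_integral_diff(2)[OF _ set_integrable_scaleR_right])
      (simp_all only: set_integral_scaleR_right set_integrable_hankel r assms(2) \<nu> \<nu>1)
  finally show ?thesis by simp
qed

section \<open>Rapid decay of transforms of even functions\<close>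

lemma schwartz_times_ident:
  assumes "f \<in> schwartz"
  shows "(\<lambda>t. of_real t * f t) \<in> schwartz"
  using schwartz_power_compose[OF assms, of 1 1] by simp

text \<open>The derivative of an even function is odd, hence vanishes at 0 and is divisible by t;
  the quotient is even again.\<close>

lemma even_schwartz_derivE:
  assumes "g \<in> even_schwartz"
  obtains q where "q \<in> even_schwartz" "\<And>t. (g has_vector_derivative of_real t * q t) (at t)"
proof -
  have g: "g \<in> schwartz" "\<And>t. g (- t) = g t" using assms by (auto simp: even_schwartz_def)
  obtain g' where g': "g' \<in> schwartz" "\<And>t. (g has_vector_derivative g' t) (at t)"
    using g(1) by (rule schwartz_derivE) blast
  have odd: "g' (- t) = - g' t" for t
  proof -
    have "((\<lambda>t. g (- t)) has_vector_derivative (- 1) *\<^sub>R g' (- t)) (at t)"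
      using DERIV_minus[OF DERIV_ident] g'(2) by (rule has_vector_derivative_compose_real)
    then have "(g has_vector_derivative - g' (- t)) (at t)" by (simp add: g(2))
    then have "- g' (- t) = g' t" using g'(2) by (rule vector_derivative_unique_at)
    then show ?thesis by (metis minus_minus)
  qed
  have "g' 0 = 0" using odd[of 0] by simp
  with g'(1) obtain q where q: "q \<in> schwartz" "\<And>t. g' t = of_real t * q t"
    by (rule schwartz_divide) blast
  have "q (- t) = q t" for t
    using odd[of t] by (cases "t = 0") (auto simp: q(2))
  then show ?thesis using that q g'(2) by (auto simp: even_schwartz_def)
qed

lemma hankel_times_square:
  assumes \<nu>: "\<nu> \<ge> - 1 / 2" and "g \<in> even_schwartz"
  obtains r where "r \<in> even_schwartz" "\<And>u. (c * u)\<^sup>2 *\<^sub>R hankel c \<nu> g u = - hankel c \<nu> r u"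
proof -
  obtain q where q: "q \<in> even_schwartz" "\<And>t. (g has_vector_derivative of_real t * q t) (at t)"
    using assms(2) by (rule even_schwartz_derivE) blast
  obtain p where p: "p \<in> even_schwartz" "\<And>t. (q has_vector_derivative of_real t * p t) (at t)"
    using q(1) by (rule even_schwartz_derivE) blast
  have s: "g \<in> schwartz" "q \<in> schwartz" "p \<in> schwartz"
    using assms(2) p(1) q(1) by (auto simp: even_schwartz_def)
  \<comment> \<open>The derivative of q is written as t p with p even, which makes \<open>?r\<close>
    visibly even.\<close>
  let ?r = "\<lambda>t. of_real (2 * \<nu> + 2) * q t + of_real t * (of_real t * p t)"
  show ?thesis
  proof
    have "?r \<in> schwartz" by (intro schwartz_add schwartz_cmult schwartz_times_ident s)
    then show "?r \<in> even_schwartz" using q(1) p(1) by (simp add: even_schwartz_def)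
    fix u
    have d: "2 * \<nu> + 2 \<noteq> 0" using \<nu> by simp
    have "(2 * \<nu> + 2) *\<^sub>R hankel c \<nu> g u = - hankel c (\<nu> + 1) q u"
      using hankel_raise_order[OF \<nu> s(1,2) schwartz_times_ident[OF s(2)] q(2), of c u]
      by (rule eq_neg_iff_add_eq_0[THEN iffD2])
    then have "((c * u)\<^sup>2 / (2 * \<nu> + 2)) *\<^sub>R ((2 * \<nu> + 2) *\<^sub>R hankel c \<nu> g u)
        = - (((c * u)\<^sup>2 / (2 * \<nu> + 2)) *\<^sub>R hankel c (\<nu> + 1) q u)"
      by simp
    also have "\<dots> = - hankel c \<nu> ?r u"
      by (subst hankel_lower_order[OF \<nu> s(2) _ _ p(2)]) (auto intro!: schwartz_times_ident s)
    finally show "(c * u)\<^sup>2 *\<^sub>R hankel c \<nu> g u = - hankel c \<nu> ?r u"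
      using d by simp
  qed
qed

text \<open>Every induction step trades a factor u^2 for a new even function, until the bound
  uniform in u applies. Hence only even powers appear.\<close>

lemma hankel_decay:
  assumes "\<nu> \<ge> - 1 / 2" "c > 0" "g \<in> even_schwartz"
  shows "\<exists>K. \<forall>u. \<bar>u\<bar> ^ (2 * m) * norm (hankel c \<nu> g u) \<le> K"
  using assms(3)
proof (induction m arbitrary: g)
  case 0
  then show ?case using norm_hankel_le[OF assms(1), of g c] by (auto simp: even_schwartz_def)
next
  case (Suc m)
  obtain r where r: "r \<in> even_schwartz" "\<And>u. (c * u)\<^sup>2 *\<^sub>R hankel c \<nu> g u = - hankel c \<nu> r u"
    using assms(1) Suc.prems by (rule hankel_times_square) blast
  obtain K where K: "\<And>u. \<bar>u\<bar> ^ (2 * m) * norm (hankel c \<nu> r u) \<le> K"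
    using Suc.IH[OF r(1)] by blast
  have "\<bar>u\<bar> ^ (2 * Suc m) * norm (hankel c \<nu> g u) \<le> K / c\<^sup>2" for u
  proof -
    have "norm ((c * u)\<^sup>2 *\<^sub>R hankel c \<nu> g u) = norm (hankel c \<nu> r u)"
      unfolding r(2) by simp
    then have "c\<^sup>2 * (u\<^sup>2 * norm (hankel c \<nu> g u)) = norm (hankel c \<nu> r u)"
      by (simp add: power_mult_distrib)
    then have "\<bar>u\<bar> ^ (2 * m) * (c\<^sup>2 * (u\<^sup>2 * norm (hankel c \<nu> g u))) \<le> K"
      using K[of u] by simp
    then show ?thesis
      using assms(2) by (simp add: pos_le_divide_eq mult_ac power2_eq_square abs_mult_self_eq)
  qed
  then show ?case by blast
qed

section \<open>Differentiation of the transform and the Schwartz property\<close>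

lemma has_vector_derivative_quadratic_remainder:
  fixes F :: "real \<Rightarrow> 'a::real_normed_vector"
  assumes "\<And>v. norm (F v - F u - (v - u) *\<^sub>R D) \<le> C * (v - u)\<^sup>2"
  shows "(F has_vector_derivative D) (at u)"
  unfolding has_vector_derivative_def
proof (rule has_derivativeI_sandwich[where e = 1 and H = "\<lambda>v. C * \<bar>v - u\<bar>"])
  fix v :: real assume "v \<noteq> u"
  moreover have "norm (F v - F u - (v - u) *\<^sub>R D) \<le> (C * \<bar>v - u\<bar>) * \<bar>v - u\<bar>"
    using assms[of v] by (simp add: power2_eq_square abs_mult_self_eq mult.assoc)
  ultimately show "norm (F v - F u - (v - u) *\<^sub>R D) / norm (v - u) \<le> C * \<bar>v - u\<bar>"
    by (simp add: pos_divide_le_eq)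
next
  have "((\<lambda>v. C * \<bar>v - u\<bar>) \<longlongrightarrow> C * \<bar>u - u\<bar>) (at u)" by (intro tendsto_intros)
  then show "((\<lambda>v. C * \<bar>v - u\<bar>) \<longlongrightarrow> 0) (at u)" by simp
qed (auto intro: bounded_linear_scaleR_left)

text \<open>The uniform Taylor estimate of the kernel is integrated, which replaces an interchange
  of limit and integral. Its remainder carries t^2, and t^2 turns the weight of order \<nu> into the
  still integrable one of order \<nu> + 1.\<close>

lemma hankel_has_vector_derivative:
  assumes \<nu>: "\<nu> \<ge> - 1 / 2" and g: "g \<in> schwartz"
  shows "(hankel c \<nu> g has_vector_derivative - (c\<^sup>2 * u / (2 * \<nu> + 2)) *\<^sub>R hankel c (\<nu> + 1) g u) (at u)"
proof (rule has_vector_derivative_quadratic_remainder)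
  fix v
  let ?w = "\<lambda>t. t powr (2 * \<nu> + 1)" and ?w' = "\<lambda>t. t powr (2 * (\<nu> + 1) + 1)"
  let ?d = "- (c\<^sup>2 * u / (2 * \<nu> + 2))"
  let ?R = "\<lambda>t. ((?w t * bessel_entire \<nu> (c * t * v)) *\<^sub>R g t - (?w t * bessel_entire \<nu> (c * t * u)) *\<^sub>R g t)
      - (v - u) *\<^sub>R (?d *\<^sub>R ((?w' t * bessel_entire (\<nu> + 1) (c * t * u)) *\<^sub>R g t))"
  have i: "set_integrable lborel {0<..} (\<lambda>t. (?w t * bessel_entire \<nu> (c * t * x)) *\<^sub>R g t)"
    "set_integrable lborel {0<..} (\<lambda>t. (?w' t * bessel_entire (\<nu> + 1) (c * t * x)) *\<^sub>R g t)" for x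
    using set_integrable_hankel[OF \<nu> g] set_integrable_hankel[OF _ g, of "\<nu> + 1"] \<nu> by auto
  have iR: "set_integrable lborel {0<..} ?R"
    by (intro set_integral_diff(1) set_integrable_scaleR_right i)
  have iw: "set_integrable lborel {0<..} (\<lambda>t. ?w' t *\<^sub>R g t)"
    using set_integrable_powr_schwartz[of "2 * (\<nu> + 1) + 1" "\<lambda>_. 1" 1 g] \<nu> g by simp
  have eq: "hankel c \<nu> g v - hankel c \<nu> g u - (v - u) *\<^sub>R (?d *\<^sub>R hankel c (\<nu> + 1) g u) = (LINT t:{0<..}|lborel. ?R t)"
    unfolding hankel_def set_integral_scaleR_right[symmetric]
    by (simp only: set_integral_diff(2)[symmetric] set_integral_diff(1) set_integrable_scaleR_right i)
  have "norm (hankel c \<nu> g v - hankel c \<nu> g u - (v - u) *\<^sub>R (?d *\<^sub>R hankel c (\<nu> + 1) g u))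
      \<le> (LINT t:{0<..}|lborel. norm (?R t))"
    unfolding eq by (rule set_integral_norm_bound[OF iR])
  also have "\<dots> \<le> (LINT t:{0<..}|lborel. (2 * c\<^sup>2 * (v - u)\<^sup>2) * norm (?w' t *\<^sub>R g t))"
  proof (rule set_integral_mono)
    show "set_integrable lborel {0<..} (\<lambda>t. norm (?R t))" using iR by (rule set_integrable_norm)
    show "set_integrable lborel {0<..} (\<lambda>t. (2 * c\<^sup>2 * (v - u)\<^sup>2) * norm (?w' t *\<^sub>R g t))"
      by (rule set_integrable_mult_right[OF set_integrable_norm[OF iw]])
    fix t :: real assume "t \<in> {0<..}"
    then have t: "t > 0" by simp
    have "?w' t = t powr (2 * \<nu> + 2) * t" "t powr (2 * \<nu> + 2) = ?w t * t"
      using t by (auto intro!: powr_eq_times)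
    then have w: "?w' t = ?w t * t\<^sup>2" by (simp add: power2_eq_square)
    let ?T = "bessel_entire \<nu> (c * t * v) - bessel_entire \<nu> (c * t * u)
      - (c * t * v - c * t * u) * bessel_entire' \<nu> (c * t * u)"
    \<comment> \<open>The formula for j_\<nu>' together with \<open>?w' t = ?w t * t\<^sup>2\<close>
      shows that the proposed derivative is the linear Taylor term in c t u.\<close>
    have "?R t = (?w t * ?T) *\<^sub>R g t"
      unfolding w bessel_entire'_def by (simp add: scaleR_conv_of_real algebra_simps power2_eq_square)
    then have "norm (?R t) = ?w t * norm (g t) * \<bar>?T\<bar>" by (simp add: abs_mult)
    also have "\<dots> \<le> ?w t * norm (g t) * (2 * (c * t * v - c * t * u)\<^sup>2)"
      by (intro mult_left_mono bessel_entire_taylor \<nu>) auto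
    also have "(c * t * v - c * t * u)\<^sup>2 = c\<^sup>2 * t\<^sup>2 * (v - u)\<^sup>2"
      by (simp add: power_mult_distrib flip: right_diff_distrib)
    also have "?w t * norm (g t) * (2 * (c\<^sup>2 * t\<^sup>2 * (v - u)\<^sup>2))
        = (2 * c\<^sup>2 * (v - u)\<^sup>2) * norm (?w' t *\<^sub>R g t)"
      unfolding w by (simp add: mult_ac)
    finally show "norm (?R t) \<le> (2 * c\<^sup>2 * (v - u)\<^sup>2) * norm (?w' t *\<^sub>R g t)" .
  qed
  also have "\<dots> = (2 * c\<^sup>2 * (LINT t:{0<..}|lborel. norm (?w' t *\<^sub>R g t))) * (v - u)\<^sup>2"
    by (simp only: set_integral_mult_right mult_ac)
  finally show "norm (hankel c \<nu> g v - hankel c \<nu> g u - (v - u) *\<^sub>R (?d *\<^sub>R hankel c (\<nu> + 1) g u))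
      \<le> (2 * c\<^sup>2 * (LINT t:{0<..}|lborel. norm (?w' t *\<^sub>R g t))) * (v - u)\<^sup>2" .
qed

text \<open>The derivative of u^k times a transform of order \<nu> combines u^(k - 1) at order \<nu>
  with u^(k + 1) at order \<nu> + 1; letting k and \<nu> vary closes the family.\<close>

lemma hankel_schwartz:
  assumes "\<nu> \<ge> - 1 / 2" "c > 0" "g \<in> even_schwartz"
  shows "hankel c \<nu> g \<in> schwartz"
proof (rule schwartz_coinduct)
  let ?S = "{\<lambda>u. of_real (u ^ k) * hankel c \<nu> g u | k \<nu> g. \<nu> \<ge> - 1 / 2 \<and> g \<in> even_schwartz}"
  have "(\<lambda>u. of_real (u ^ 0) * hankel c \<nu> g u) \<in> lin ?S"
    using assms by (intro lin.base) blast
  then show "hankel c \<nu> g \<in> lin ?S" by simp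
  fix f assume "f \<in> ?S"
  then obtain k \<nu> g where f: "f = (\<lambda>u. of_real (u ^ k) * hankel c \<nu> g u)"
    and \<nu>: "\<nu> \<ge> - 1 / 2" and g: "g \<in> even_schwartz" by blast
  show "rapidly_decreasing f"
  proof (rule rapidly_decreasingI)
    fix m
    obtain K where K: "\<And>u. \<bar>u\<bar> ^ (2 * (m + k)) * norm (hankel c \<nu> g u) \<le> K"
      using hankel_decay[OF \<nu> assms(2) g] by blast
    obtain L where L: "\<And>u. \<bar>u\<bar> ^ (2 * 0) * norm (hankel c \<nu> g u) \<le> L"
      using hankel_decay[OF \<nu> assms(2) g] by blast
    have "\<bar>u\<bar> ^ m * norm (f u) \<le> K + L" for u
    proof -
      \<comment> \<open>Decay is known for even exponents only; any power is bounded by its square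
        plus 1.\<close>
      have "\<bar>u\<bar> ^ (m + k) \<le> \<bar>u\<bar> ^ (2 * (m + k)) + 1"
      proof (cases "\<bar>u\<bar> \<le> 1")
        case True
        then have "\<bar>u\<bar> ^ (m + k) \<le> 1" by (intro power_le_one) auto
        then show ?thesis by (simp add: add_increasing)
      next
        case False
        then have "\<bar>u\<bar> ^ (m + k) \<le> \<bar>u\<bar> ^ (2 * (m + k))" by (intro power_increasing) auto
        then show ?thesis by simp
      qed
      then have "\<bar>u\<bar> ^ (m + k) * norm (hankel c \<nu> g u)
          \<le> (\<bar>u\<bar> ^ (2 * (m + k)) + 1) * norm (hankel c \<nu> g u)"
        by (intro mult_right_mono) auto
      also have "\<dots> \<le> K + L" using K[of u] L[of u] by (simp add: distrib_right)
      finally show ?thesis by (simp add: f norm_mult norm_power power_add mult.assoc)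
    qed
    then show "\<exists>K. \<forall>u. \<bar>u\<bar> ^ m * norm (f u) \<le> K" by blast
  qed
  let ?f' = "\<lambda>u. of_nat k * (of_real (u ^ (k - 1)) * hankel c \<nu> g u)
      + of_real (- (c\<^sup>2 / (2 * \<nu> + 2))) * (of_real (u ^ (k + 1)) * hankel c (\<nu> + 1) g u)"
  have "(\<lambda>u. of_real (u ^ (k - 1)) * hankel c \<nu> g u) \<in> ?S" using \<nu> g by blast
  moreover have "(\<lambda>u. of_real (u ^ (k + 1)) * hankel c (\<nu> + 1) g u) \<in> ?S"
  proof -
    have "\<nu> + 1 \<ge> - 1 / 2" using \<nu> by simp
    then show ?thesis using g by blast
  qed
  ultimately have "?f' \<in> lin ?S" by (intro lin.add lin.cmult lin.base)
  moreover have "(f has_vector_derivative ?f' u) (at u)" for u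
  proof -
    have k: "((\<lambda>x. x ^ k) has_real_derivative real k * u ^ (k - 1)) (at u)"
      by (auto intro!: derivative_eq_intros)
    have "g \<in> schwartz" using g by (simp add: even_schwartz_def)
    from has_vector_derivative_scaleR[OF k hankel_has_vector_derivative[OF \<nu> this]]
    show ?thesis unfolding f by (simp add: scaleR_conv_of_real algebra_simps)
  qed
  ultimately show "\<exists>f' \<in> lin ?S. \<forall>u. (f has_vector_derivative f' u) (at u)"
    by (intro bexI[of _ ?f'] allI)
qed


subsection \<open>Reduction to Hankel transforms\<close>

text \<open>Under x = t ^ N the Jacobian N t ^ (N - 1) joins x powr \<beta>, and \<beta> is
  determined by N - 1 + N \<beta> = 2 \<nu> + 1.\<close>

lemma hankel_substitution:
  assumes \<nu>: "\<nu> \<ge> - 1 / 2" and g: "g \<in> schwartz" and N: "N > 0"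
    and \<beta>: "\<beta> = (2 * \<nu> + 2) / real N - 1"
  shows "(LINT x:{0<..}|lborel. (x powr \<beta> * bessel_entire \<nu> (c * x powr (1 / real N) * u)) *\<^sub>R g x)
       = real N *\<^sub>R hankel c \<nu> (\<lambda>t. g (t ^ N)) u"
proof -
  let ?f = "\<lambda>x. (x powr \<beta> * bessel_entire \<nu> (c * x powr (1 / real N) * u)) *\<^sub>R g x"
  let ?h = "\<lambda>t. (t powr (2 * \<nu> + 1) * bessel_entire \<nu> (c * t * u)) *\<^sub>R g (t ^ N)"
  have gN: "(\<lambda>t. g (t ^ N)) \<in> schwartz" using schwartz_power_compose[OF g N, of 0] by simp
  have "\<beta> > - 1" using \<nu> N by (simp add: \<beta>)
  have eq: "(real N * t ^ (N - 1)) *\<^sub>R ?f (t ^ N) = real N *\<^sub>R ?h t" if t: "t > 0" for t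
  proof -
    have root: "(t ^ N) powr (1 / real N) = t"
      using t N by (simp add: powr_realpow[symmetric] powr_powr)
    have "t ^ (N - 1) * (t ^ N) powr \<beta> = t powr (real (N - 1) + real N * \<beta>)"
      using t by (simp add: powr_realpow[symmetric] powr_powr powr_add del: of_nat_diff)
    also have "real (N - 1) + real N * \<beta> = 2 * \<nu> + 1"
      using N by (simp add: \<beta> of_nat_diff field_simps)
    finally have "t ^ (N - 1) * (t ^ N) powr \<beta> = t powr (2 * \<nu> + 1)" .
    then have "real N * t ^ (N - 1) * ((t ^ N) powr \<beta> * bessel_entire \<nu> (c * t * u))
        = real N * (t powr (2 * \<nu> + 1) * bessel_entire \<nu> (c * t * u))"
      by (metis mult.assoc)
    then show ?thesis unfolding root by simp
  qed
  have "(LBINT x=0..\<infinity>. ?f x) = (LBINT t=0..\<infinity>. (real N * t ^ (N - 1)) *\<^sub>R ?f (t ^ N))"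
  proof (rule interval_integral_substitution_integrable)
    fix t :: real assume "0 < ereal t"
    then have t: "t > 0" by simp
    show "((\<lambda>t. t ^ N) has_real_derivative real N * t ^ (N - 1)) (at t)"
      by (auto intro!: derivative_eq_intros)
    have "continuous_on {0<..} ?f"
      by (intro continuous_intros \<nu> continuous_on_schwartz[OF g]) auto
    then show "isCont ?f (t ^ N)" using t by (simp add: continuous_on_eq_continuous_at)
    show "isCont (\<lambda>t. real N * t ^ (N - 1)) t" by (intro continuous_intros)
  next
    fix t :: real assume "0 \<le> ereal t"
    then show "0 \<le> real N * t ^ (N - 1)" by simp
  next
    have "((\<lambda>t::real. t ^ N) \<longlongrightarrow> 0 ^ N) (at_right 0)" by (intro tendsto_intros)
    then have "((\<lambda>t. ereal (t ^ N)) \<longlongrightarrow> ereal 0) (at_right 0)" using N by (simp add: power_0_left)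
    then show "((ereal \<circ> (\<lambda>t. t ^ N) \<circ> real_of_ereal) \<longlongrightarrow> 0) (at_right 0)"
      unfolding zero_ereal_def ereal_tendsto_simps by (simp add: o_def)
    have "LIM t at_top. (t::real) ^ N :> at_top"
      by (intro filterlim_pow_at_top N filterlim_ident)
    then show "((ereal \<circ> (\<lambda>t. t ^ N) \<circ> real_of_ereal) \<longlongrightarrow> \<infinity>) (at_left \<infinity>)"
      unfolding ereal_tendsto_simps by (simp add: o_def)
  next
    have "set_integrable lborel {0<..} (\<lambda>t. real N *\<^sub>R ?h t)"
      by (intro set_integrable_scaleR_right set_integrable_hankel \<nu> gN)
    then have "set_integrable lborel {0<..} (\<lambda>t. (real N * t ^ (N - 1)) *\<^sub>R ?f (t ^ N))"
      by (subst set_integrable_cong[OF refl refl eq]) auto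
    then show "set_integrable lborel (einterval 0 \<infinity>) (\<lambda>t. (real N * t ^ (N - 1)) *\<^sub>R ?f (t ^ N))"
      unfolding zero_ereal_def einterval_eq .
  next
    have "set_integrable lborel {0<..} ?f"
      by (rule set_integrable_powr_schwartz[OF \<open>\<beta> > - 1\<close> _ abs_bessel_entire_le[OF \<nu>] g])
        (auto intro!: continuous_intros \<nu>)
    then show "set_integrable lborel (einterval 0 \<infinity>) ?f"
      unfolding zero_ereal_def einterval_eq .
  qed simp
  then have "(LINT x:{0<..}|lborel. ?f x) = (LINT t:{0<..}|lborel. (real N * t ^ (N - 1)) *\<^sub>R ?f (t ^ N))"
    by (simp only: interval_lebesgue_integral_0_infty)
  also have "\<dots> = (LINT t:{0<..}|lborel. real N *\<^sub>R ?h t)"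
    by (rule set_lebesgue_integral_cong) (use eq in auto)
  finally show ?thesis by (simp only: set_integral_scaleR_right hankel_def)
qed

lemma integral_lborel_fold:
  fixes F :: "real \<Rightarrow> 'a::{banach, second_countable_topology}"
  assumes [measurable]: "F \<in> borel_measurable borel"
    and pos: "set_integrable lborel {0<..} F" and neg: "set_integrable lborel {0<..} (\<lambda>x. F (- x))"
  shows "integral\<^sup>L lborel F = (LINT x:{0<..}|lborel. F x + F (- x))"
proof -
  let ?n = "\<lambda>x. indicator {..<0} x *\<^sub>R F x"
  have refl: "?n (0 + - 1 * x) = indicator {0<..} x *\<^sub>R F (- x)" for x
    by (simp add: indicator_def)
  have "integrable lborel (\<lambda>x. ?n (0 + - 1 * x))"
    using neg unfolding refl set_integrable_def .
  then have n: "integrable lborel ?n"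
    by (subst (asm) lborel_integrable_real_affine_iff) auto
  have "(LINT x|lborel. ?n x) = (LINT x|lborel. ?n (0 + - 1 * x))"
    by (subst lborel_integral_real_affine[where c = "- 1" and t = 0]) auto
  also have "\<dots> = (LINT x:{0<..}|lborel. F (- x))"
    unfolding refl set_lebesgue_integral_def ..
  finally have *: "(LINT x|lborel. ?n x) = (LINT x:{0<..}|lborel. F (- x))" .
  have "integral\<^sup>L lborel F = (LINT x|lborel. indicator {0<..} x *\<^sub>R F x + ?n x)"
  proof (rule integral_cong_AE)
    have "AE x in lborel. x \<noteq> (0::real)" by (rule AE_lborel_singleton)
    then show "AE x in lborel. F x = indicator {0<..} x *\<^sub>R F x + ?n x"
      by eventually_elim (auto simp: indicator_def)
  qed auto
  also have "\<dots> = (LINT x:{0<..}|lborel. F x) + (LINT x:{0<..}|lborel. F (- x))"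
    using pos n * unfolding set_integrable_def
    by (subst Bochner_Integration.integral_add) (simp_all add: set_lebesgue_integral_def)
  also have "\<dots> = (LINT x:{0<..}|lborel. F x + F (- x))"
    by (rule set_integral_add(2)[OF pos neg, symmetric])
  finally show ?thesis .
qed

text \<open>For even \<open>N\<close> the inner power absorbs the sign; for odd \<open>N\<close> the
  sign passes through to \<open>g\<close>.\<close>

lemma even_schwartz_power_compose:
  assumes "g \<in> even_schwartz" "N > 0"
  shows "(\<lambda>t. g (t ^ N)) \<in> even_schwartz"
proof -
  have "(\<lambda>t. g (t ^ N)) \<in> schwartz"
    using schwartz_power_compose[of g N 0] assms by (simp add: even_schwartz_def)
  moreover have "g ((- t) ^ N) = g (t ^ N)" for t
    using assms(1) by (cases "even N") (auto simp: even_schwartz_def power_minus_odd)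
  ultimately show ?thesis by (simp add: even_schwartz_def)
qed

lemma B_kernel_eq:
  assumes "a > 0" "lam \<kappa> a \<ge> - 1 / 2"
  shows "B_kernel \<kappa> a x y =
     of_real (bessel_entire (lam \<kappa> a) (2 / a * \<bar>x\<bar> powr (a / 2) * \<bar>y\<bar> powr (a / 2)))
     + of_real (Gamma (lam \<kappa> a + 1) / Gamma (lam \<kappa> a + 1 + 2 / a))
       * exp (- \<i> * of_real (pi / a)) / of_real (a powr (2 / a)) * of_real y * of_real x
       * of_real (bessel_entire (lam \<kappa> a + 2 / a) (2 / a * \<bar>x\<bar> powr (a / 2) * \<bar>y\<bar> powr (a / 2)))"
proof -
  have "0 \<le> 2 / a" using assms by simp
  then have "lam \<kappa> a + 2 / a \<ge> - 1 / 2" using assms by linarith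
  moreover have "2 / a * \<bar>x * y\<bar> powr (a / 2) \<ge> 0" using assms by simp
  ultimately have "normalized_bessel (lam \<kappa> a) (2 / a * \<bar>x * y\<bar> powr (a / 2))
      = bessel_entire (lam \<kappa> a) (2 / a * \<bar>x * y\<bar> powr (a / 2))"
    "normalized_bessel (lam \<kappa> a + 2 / a) (2 / a * \<bar>x * y\<bar> powr (a / 2))
      = bessel_entire (lam \<kappa> a + 2 / a) (2 / a * \<bar>x * y\<bar> powr (a / 2))"
    using assms by (auto intro!: normalized_bessel_eq)
  then show ?thesis
    by (simp add: B_kernel_def abs_mult powr_mult mult_ac)
qed

text \<open>The first kernel term is even in x and meets f (x) + f (- x). The second is odd and
  meets f (x) - f (- x) = x q (x); its own factor x and this one raise the density exponent by 2. In
  2 / a / \<open>C\<close> the numerator 2 / a is the Jacobian factor N and \<open>C\<close> the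
  normalisation of the measure.\<close>

lemma gen_fourier_eq_hankel:
  fixes a \<kappa> y :: real and f :: "real \<Rightarrow> complex"
  assumes a: "a > 0" and N: "real N = 2 / a" and lam: "lam \<kappa> a \<ge> - 1 / 2" and f: "f \<in> schwartz"
    and q: "q \<in> schwartz" "\<And>x. f x - f (- x) = of_real x * q x"
  defines "C \<equiv> 2 * a powr lam \<kappa> a * Gamma (lam \<kappa> a + 1)"
    and "D \<equiv> of_real (Gamma (lam \<kappa> a + 1) / Gamma (lam \<kappa> a + 1 + 2 / a))
       * exp (- \<i> * of_real (pi / a)) / of_real (a powr (2 / a))"
  shows "gen_fourier \<kappa> a f y =
      of_real (2 / a / C) * hankel (2 / a) (lam \<kappa> a) (\<lambda>t. f (t ^ N) + f (- (t ^ N))) (\<bar>y\<bar> powr (a / 2))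
      + of_real y * (of_real (2 / a / C) * D
        * hankel (2 / a) (lam \<kappa> a + 2 / a) (\<lambda>t. q (t ^ N)) (\<bar>y\<bar> powr (a / 2)))"
proof -
  define u where "u = \<bar>y\<bar> powr (a / 2)"
  define \<eta> where "\<eta> = lam \<kappa> a"
  define \<mu> where "\<mu> = lam \<kappa> a + 2 / a"
  define \<alpha> where "\<alpha> = 2 * \<kappa> + a - 2"
  define J where "J \<nu> x = bessel_entire \<nu> (2 / a * \<bar>x\<bar> powr (a / 2) * u)" for \<nu> x
  define h where "h x = (of_real (J \<eta> x) + D * of_real y * of_real x * of_real (J \<mu> x)) * f x" for x
  have a2: "2 / a > 0" using a by simp
  have N0: "N > 0" using N a2 by (metis of_nat_0_less_iff)
  have \<eta>: "\<eta> \<ge> - 1 / 2" using lam by (simp add: \<eta>_def)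
  have \<mu>: "\<mu> \<ge> - 1 / 2" using \<eta> a2 unfolding \<eta>_def \<mu>_def by linarith
  have a1: "1 / real N = a / 2" unfolding N by simp
  have \<kappa>: "2 * \<kappa> - 1 = a * \<eta>" using a by (simp add: \<eta>_def lam_def)
  \<comment> \<open>With 1 / N = a / 2 and a \<eta> = 2 \<kappa> - 1 the density exponent is the
    \<beta> of the substitution at order \<eta>. Raising it by 2 adds 2 / a to the order, which is
    the order of the second Bessel function in the kernel.\<close>
  have e1: "\<alpha> = (2 * \<eta> + 2) / real N - 1"
    unfolding N using a \<kappa> by (simp add: \<alpha>_def field_simps)
  have e2: "\<alpha> + 2 = (2 * \<mu> + 2) / real N - 1"
    unfolding N using a \<kappa> by (simp add: \<alpha>_def \<mu>_def \<eta>_def[symmetric] field_simps)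
  have "(2 * \<eta> + 2) / real N > 0" using \<eta> N0 by simp
  then have \<alpha>: "\<alpha> > - 1" unfolding e1 by linarith
  have C: "C > 0" unfolding C_def using \<eta> a by (intro mult_pos_pos Gamma_real_pos) (auto simp: \<eta>_def)
  have Jc: "continuous_on A (J \<nu>)" if "\<nu> \<ge> - 1 / 2" for A \<nu>
    unfolding J_def[abs_def] using that a
    by (intro continuous_on_bessel_entire continuous_on_mult continuous_on_powr' continuous_on_const
        continuous_on_rabs continuous_on_id) auto
  have Jb: "\<bar>J \<nu> x\<bar> \<le> 1" if "\<nu> \<ge> - 1 / 2" for \<nu> x
    unfolding J_def using that by (rule abs_bessel_entire_le)
  have J_even: "J \<nu> (- x) = J \<nu> x" for \<nu> x by (simp add: J_def)
  have fr: "(\<lambda>x. f (- x)) \<in> schwartz" using f by (rule schwartz_reflect)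
  have h[measurable]: "h \<in> borel_measurable borel"
    unfolding h_def[abs_def] using continuous_on_schwartz[OF f continuous_on_id]
    by (intro borel_measurable_continuous_onI continuous_intros Jc \<eta> \<mu>) auto
  define F where "F x = (\<bar>x\<bar> powr \<alpha> / C) *\<^sub>R h x" for x
  have i: "set_integrable lborel {0<..} (\<lambda>x. (x powr p * J \<nu> x) *\<^sub>R g x)"
    if "p > - 1" "\<nu> \<ge> - 1 / 2" "g \<in> schwartz" for p \<nu> g
    by (rule set_integrable_powr_schwartz[OF that(1) Jc[OF that(2)] Jb[OF that(2)] that(3)])
  have iq: "set_integrable lborel {0<..} (\<lambda>x. (x powr (\<alpha> + 2) * J \<mu> x) *\<^sub>R q x)"
    using \<alpha> by (intro i \<mu> q(1)) simp
  have "gen_fourier \<kappa> a f y = (LINT x|mu \<kappa> a. h x)"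
    unfolding gen_fourier_def B_kernel_eq[OF a lam]
    by (simp add: h_def J_def u_def D_def \<eta>_def \<mu>_def mult_ac)
  also have "\<dots> = integral\<^sup>L lborel F"
    unfolding mu_def F_def[abs_def] \<alpha>_def[symmetric] C_def[symmetric]
    using C by (subst integral_density) auto
  also have "\<dots> = (LINT x:{0<..}|lborel. F x + F (- x))"
  proof (rule integral_lborel_fold)
    have F: "(x powr \<alpha> / C) *\<^sub>R (of_real (J \<eta> x) + s * of_real x * of_real (J \<mu> x)) * g x
        = (1 / C) *\<^sub>R ((x powr \<alpha> * J \<eta> x) *\<^sub>R g x + s * ((x powr \<alpha> * J \<mu> x) *\<^sub>R (of_real x * g x)))"
      for x s and g :: "real \<Rightarrow> complex"
      by (simp add: scaleR_conv_of_real divide_inverse algebra_simps)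
    have iF: "set_integrable lborel {0<..} (\<lambda>x. (x powr \<alpha> / C) *\<^sub>R (of_real (J \<eta> x)
        + s * of_real x * of_real (J \<mu> x)) * g x)" if "g \<in> schwartz" for s g
      unfolding F
      by (intro set_integrable_scaleR_right set_integral_add(1) set_integrable_mult_right i \<alpha> \<eta> \<mu>
          that schwartz_times_ident)
    have "set_integrable lborel {0<..} F \<longleftrightarrow> set_integrable lborel {0<..} (\<lambda>x. (x powr \<alpha> / C) *\<^sub>R
        (of_real (J \<eta> x) + (D * of_real y) * of_real x * of_real (J \<mu> x)) * f x)"
      by (intro set_integrable_cong refl) (simp add: F_def h_def)
    then show "set_integrable lborel {0<..} F" using iF[OF f] by blast
    have "set_integrable lborel {0<..} (\<lambda>x. F (- x)) \<longleftrightarrow> set_integrable lborel {0<..} (\<lambda>x. (x powr \<alpha> / C) *\<^sub>R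
        (of_real (J \<eta> x) + (- (D * of_real y)) * of_real x * of_real (J \<mu> x)) * f (- x))"
      by (intro set_integrable_cong refl) (simp add: F_def h_def J_even)
    then show "set_integrable lborel {0<..} (\<lambda>x. F (- x))" using iF[OF fr] by blast
  qed (simp add: F_def[abs_def])
  also have "\<dots> = (LINT x:{0<..}|lborel. (1 / C) *\<^sub>R ((x powr \<alpha> * J \<eta> x) *\<^sub>R (f x + f (- x))
      + (D * of_real y) * ((x powr (\<alpha> + 2) * J \<mu> x) *\<^sub>R q x)))"
  proof (rule set_lebesgue_integral_cong, safe)
    fix x :: real assume x: "x > 0"
    then have p: "x powr (\<alpha> + 2) = x powr \<alpha> * x * x"
      by (subst powr_eq_times[OF x, of _ "\<alpha> + 1"], simp, subst powr_eq_times[OF x, of _ \<alpha>], simp_all)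
    have "F x + F (- x) = (x powr \<alpha> / C) *\<^sub>R (of_real (J \<eta> x) * (f x + f (- x))
        + D * of_real y * of_real x * of_real (J \<mu> x) * (f x - f (- x)))"
      using x by (simp add: F_def h_def J_even scaleR_conv_of_real algebra_simps)
    then show "F x + F (- x) = (1 / C) *\<^sub>R ((x powr \<alpha> * J \<eta> x) *\<^sub>R (f x + f (- x))
      + (D * of_real y) * ((x powr (\<alpha> + 2) * J \<mu> x) *\<^sub>R q x))"
      unfolding q(2) p by (simp add: scaleR_conv_of_real divide_inverse algebra_simps)
  qed simp
  also have "\<dots> = (1 / C) *\<^sub>R ((LINT x:{0<..}|lborel. (x powr \<alpha> * J \<eta> x) *\<^sub>R (f x + f (- x)))
      + (D * of_real y) * (LINT x:{0<..}|lborel. (x powr (\<alpha> + 2) * J \<mu> x) *\<^sub>R q x))"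
    unfolding set_integral_scaleR_right
    by (simp only: set_integral_add(2)[OF i[OF \<alpha> \<eta> schwartz_add[OF f fr]]
        set_integrable_mult_right[OF iq]] set_integral_mult_right)
  also have "(LINT x:{0<..}|lborel. (x powr \<alpha> * J \<eta> x) *\<^sub>R (f x + f (- x)))
      = (2 / a) *\<^sub>R hankel (2 / a) \<eta> (\<lambda>t. f (t ^ N) + f (- (t ^ N))) u"
    using hankel_substitution[OF \<eta> schwartz_add[OF f fr] N0 e1, of "2 / a" u]
    unfolding a1 N by (subst set_lebesgue_integral_cong) (auto simp: J_def)
  also have "(LINT x:{0<..}|lborel. (x powr (\<alpha> + 2) * J \<mu> x) *\<^sub>R q x)
      = (2 / a) *\<^sub>R hankel (2 / a) \<mu> (\<lambda>t. q (t ^ N)) u"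
    using hankel_substitution[OF \<mu> q(1) N0 e2, of "2 / a" u]
    unfolding a1 N by (subst set_lebesgue_integral_cong) (auto simp: J_def)
  finally show ?thesis
    by (simp add: u_def \<eta>_def \<mu>_def scaleR_conv_of_real algebra_simps)
qed

theorem proposition5p4:
  fixes a \<kappa> :: real and f :: "real \<Rightarrow> complex"
  assumes "a > 0" and "2 / a \<in> \<nat>"
    and "\<kappa> \<ge> 0" and "lam \<kappa> a \<ge> - 1 / 2"
    and "f \<in> schwartz"
  shows "\<exists>F1 F2. F1 \<in> schwartz \<and> F2 \<in> schwartz \<and>
           (\<forall>t. F1 (- t) = F1 t) \<and> (\<forall>t. F2 (- t) = F2 t) \<and>
           (\<forall>y. gen_fourier \<kappa> a f y =
                 F1 (\<bar>y\<bar> powr (a / 2)) + of_real y * F2 (\<bar>y\<bar> powr (a / 2)))"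
proof -
  obtain N where N: "real N = 2 / a" using assms(2) by (metis Nats_cases)
  have a2: "2 / a > 0" using assms(1) by simp
  then have N0: "N > 0" using N by (metis of_nat_0_less_iff)
  have fr: "(\<lambda>x. f (- x)) \<in> schwartz" using assms(5) by (rule schwartz_reflect)
  \<comment> \<open>The division takes place before the substitution: f (x) - f (- x) vanishes at 0
    and is divided by x once, after which q (t ^ N) is a mere composition and no division by t ^ N
    arises.\<close>
  obtain q where q: "q \<in> schwartz" "\<And>x. f x - f (- x) = of_real x * q x"
    using schwartz_divide[OF schwartz_diff[OF assms(5) fr]] by auto
  \<comment> \<open>Replacing x by - x changes the sign of both sides of the defining equation, so q
    is even away from 0, and trivially at 0.\<close>
  have "of_real x * q (- x) = of_real x * q x" for x
    using q(2)[of x] q(2)[of "- x"] by (simp add: algebra_simps) (metis add.inverse_inverse minus_diff_eq)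
  then have "q (- x) = q x" for x by (cases "x = 0") auto
  then have "q \<in> even_schwartz" using q(1) by (simp add: even_schwartz_def)
  then have q': "(\<lambda>t. q (t ^ N)) \<in> even_schwartz" using N0 by (rule even_schwartz_power_compose)
  have "(\<lambda>x. f x + f (- x)) \<in> even_schwartz"
    using schwartz_add[OF assms(5) fr] by (simp add: even_schwartz_def add.commute)
  then have e: "(\<lambda>t. f (t ^ N) + f (- (t ^ N))) \<in> even_schwartz"
    using even_schwartz_power_compose[OF _ N0] by blast
  have \<mu>: "lam \<kappa> a + 2 / a \<ge> - 1 / 2" using assms(4) a2 by linarith
  let ?C = "of_real (2 / a / (2 * a powr lam \<kappa> a * Gamma (lam \<kappa> a + 1)))"
  let ?D = "of_real (Gamma (lam \<kappa> a + 1) / Gamma (lam \<kappa> a + 1 + 2 / a))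
      * exp (- \<i> * of_real (pi / a)) / of_real (a powr (2 / a))"
  let ?F1 = "\<lambda>u. ?C * hankel (2 / a) (lam \<kappa> a) (\<lambda>t. f (t ^ N) + f (- (t ^ N))) u"
  let ?F2 = "\<lambda>u. ?C * ?D * hankel (2 / a) (lam \<kappa> a + 2 / a) (\<lambda>t. q (t ^ N)) u"
  have "?F1 \<in> schwartz" "?F2 \<in> schwartz"
    by (intro schwartz_cmult hankel_schwartz assms \<mu> a2 e q')+
  moreover have "gen_fourier \<kappa> a f y = ?F1 (\<bar>y\<bar> powr (a / 2)) + of_real y * ?F2 (\<bar>y\<bar> powr (a / 2))" for y
    by (rule gen_fourier_eq_hankel[OF assms(1) N assms(4,5) q])
  ultimately show ?thesis
    by (intro exI[of _ ?F1] exI[of _ ?F2] conjI allI) (simp_all only: hankel_even)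
qed

end
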